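(* Let $V$ and $X$ be reflexive Banach spaces, let $\mathbf F\in\mathcal L(V;X)$ be a bounded linear operator, and let $\mathbf M=\{\mathbf F(v)\in X: v\in V,\ |v|_V\le1\}$. The following assertions are equivalent: (1) The set $\mathbf M$ is finite codimensional in $X$. (2) The range $\mathrm{Im}(\mathbf F)$ is a finite codimensional closed subspace of $X$. (3) There exist a finite codimensional closed subspace $\widetilde X$ of $X'$ and a constant $\mathcal C>0$ such that $$|\phi|_{X'}\le\mathcal C|\mathbf F^*(\phi)|_{V'}\qquad\forall\,\phi\in\widetilde X.$$ (4) There exist a Banach space $W$, a compact linear operator $\mathcal G:X'\to W$ and a constant $\mathcal C>0$ such that $$|\phi|_{X'}\le\mathcal C\big(|\mathbf F^*(\phi)|_{V'}+|\mathcal G(\phi)|_W\big)\qquad\forall\,\phi\in X'.$$ (5) $\ker(\mathbf F^* )$ is finite-dimensional in $X'$ and $\mathrm{Im}(\mathbf F^* )$ is closed in $V'$.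
   Context: $\mathbf F^*:X'\to V'$ is the adjoint of $\mathbf F$. Finite codimensionality: a linear subspace $X_1$ of a Banach space $X$ is finite codimensional if there are an integer $m\ge0$ and linearly independent $x_1,\dots,x_m\in X\setminus X_1$ with $\overline{X_1}+\mathrm{span}\{x_1,\dots,x_m\}=X$. A subset $D\subseteq X$ is finite codimensional in $X$ if there is $x_0\in\overline{\mathrm{co}}\,D$ (closed convex hull) such that (i) $\overline{\mathrm{span}}\{D-x_0\}$ is a finite codimensional subspace of $X$, and (ii) $\overline{\mathrm{co}}(D-x_0)$ has at least one interior point relative to the space $\overline{\mathrm{span}}\{D-x_0\}$. *)

theory Defs
  imports "HOL-Analysis.Analysis"
begin

text \<open>All Banach spaces are real. The dual of \<open>'a\<close> is \<open>'a \<Rightarrow>\<^sub>L real\<close> with the operator norm.\<close>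

definition canonical_embedding :: "'a::real_normed_vector \<Rightarrow> ('a \<Rightarrow>\<^sub>L real) \<Rightarrow>\<^sub>L real"
  where "canonical_embedding = blinfun.prod_left"

lemma canonical_embedding_apply [simp]:
  "blinfun_apply (canonical_embedding x) \<phi> = blinfun_apply \<phi> x"
  by (simp add: canonical_embedding_def blinfun.prod_left.rep_eq)

definition reflexive_space :: "'a::real_normed_vector itself \<Rightarrow> bool"
  where "reflexive_space _ \<longleftrightarrow>
    surj (canonical_embedding :: 'a \<Rightarrow> ('a \<Rightarrow>\<^sub>L real) \<Rightarrow>\<^sub>L real)"

definition adjoint_op ::
  "('a::real_normed_vector \<Rightarrow>\<^sub>L 'b::real_normed_vector) \<Rightarrow> ('b \<Rightarrow>\<^sub>L real) \<Rightarrow>\<^sub>L ('a \<Rightarrow>\<^sub>L real)"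
  where "adjoint_op F = Blinfun (\<lambda>\<phi>. \<phi> o\<^sub>L F)"

lemma adjoint_op_apply [simp]: "blinfun_apply (adjoint_op F) \<phi> = \<phi> o\<^sub>L F"
  unfolding adjoint_op_def
  by (simp add: bounded_linear_Blinfun_apply
      bounded_bilinear.bounded_linear_left[OF bounded_bilinear_blinfun_compose])

definition finite_codim_subspace :: "'a::real_normed_vector set \<Rightarrow> bool"
  where "finite_codim_subspace S \<longleftrightarrow> subspace S \<and>
    (\<exists>B. finite B \<and> independent B \<and> B \<inter> S = {} \<and>
      {x + y | x y. x \<in> closure S \<and> y \<in> span B} = UNIV)"

definition finite_codim_set :: "'a::real_normed_vector set \<Rightarrow> bool"
  where "finite_codim_set D \<longleftrightarrow>
    (\<exists>x0 \<in> closure (convex hull D).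
      let D0 = (\<lambda>x. x - x0) ` D; S = closure (span D0) in
        finite_codim_subspace S \<and>
        (top_of_set S) interior_of (closure (convex hull D0)) \<noteq> {})"

text \<open>Type classes cannot express ``there exists a Banach space'' inside a formula, so the
  space \<open>W\<close> is given by a carrier set with its operations and norm.\<close>

definition carrier_dist ::
  "'w set \<Rightarrow> ('w \<Rightarrow> 'w \<Rightarrow> 'w) \<Rightarrow> (real \<Rightarrow> 'w \<Rightarrow> 'w) \<Rightarrow> ('w \<Rightarrow> real) \<Rightarrow> 'w \<Rightarrow> 'w \<Rightarrow> real"
  \<comment> \<open>Set to 0 off the carrier, because \<open>Metric_space\<close> asks for nonnegativity and symmetry everywhere.\<close>
  where "carrier_dist W add smul nrm x y =
    (if x \<in> W \<and> y \<in> W then nrm (add x (smul (-1) y)) else 0)"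

locale carrier_banach_space =
  fixes W :: "'w set" and add :: "'w \<Rightarrow> 'w \<Rightarrow> 'w" and zero :: 'w
    and smul :: "real \<Rightarrow> 'w \<Rightarrow> 'w" and nrm :: "'w \<Rightarrow> real"
  assumes zero_closed: "zero \<in> W"
    and add_closed: "\<lbrakk>x \<in> W; y \<in> W\<rbrakk> \<Longrightarrow> add x y \<in> W"
    and smul_closed: "x \<in> W \<Longrightarrow> smul a x \<in> W"
    and add_assoc: "\<lbrakk>x \<in> W; y \<in> W; z \<in> W\<rbrakk> \<Longrightarrow> add (add x y) z = add x (add y z)"
    and add_commute: "\<lbrakk>x \<in> W; y \<in> W\<rbrakk> \<Longrightarrow> add x y = add y x"
    and add_zero: "x \<in> W \<Longrightarrow> add zero x = x"
    and add_inverse: "x \<in> W \<Longrightarrow> \<exists>y\<in>W. add x y = zero"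
    and smul_add_right: "\<lbrakk>x \<in> W; y \<in> W\<rbrakk> \<Longrightarrow> smul a (add x y) = add (smul a x) (smul a y)"
    and smul_add_left: "x \<in> W \<Longrightarrow> smul (a + b) x = add (smul a x) (smul b x)"
    and smul_smul: "x \<in> W \<Longrightarrow> smul a (smul b x) = smul (a * b) x"
    and smul_one: "x \<in> W \<Longrightarrow> smul 1 x = x"
    and nrm_nonneg: "x \<in> W \<Longrightarrow> 0 \<le> nrm x"
    and nrm_eq_zero: "x \<in> W \<Longrightarrow> nrm x = 0 \<longleftrightarrow> x = zero"
    and nrm_triangle: "\<lbrakk>x \<in> W; y \<in> W\<rbrakk> \<Longrightarrow> nrm (add x y) \<le> nrm x + nrm y"
    and nrm_smul: "x \<in> W \<Longrightarrow> nrm (smul a x) = \<bar>a\<bar> * nrm x"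
    and complete: "Metric_space.mcomplete W (carrier_dist W add smul nrm)"

context carrier_banach_space
begin

lemma add_smul_minus_one:
  assumes "x \<in> W" shows "add x (smul (-1) x) = zero"
proof -
  have z: "smul 0 x = zero"
    using assms nrm_smul[of x 0] nrm_eq_zero smul_closed by simp
  have "add (smul 1 x) (smul (-1) x) = smul (1 + (-1)) x"
    using assms smul_add_left by metis
  then show ?thesis using z assms smul_one by simp
qed

lemma metric: "Metric_space W (carrier_dist W add smul nrm)"
proof
  fix x y
  show "0 \<le> carrier_dist W add smul nrm x y"
    by (simp add: carrier_dist_def add_closed smul_closed nrm_nonneg)
  show "carrier_dist W add smul nrm x y = carrier_dist W add smul nrm y x"
  proof (cases "x \<in> W \<and> y \<in> W")
    case True
    then have "smul (-1) (add x (smul (-1) y)) = add y (smul (-1) x)"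
      by (simp add: smul_add_right smul_smul smul_closed smul_one add_commute)
    then show ?thesis
      using True nrm_smul[of "add x (smul (-1) y)" "-1"]
      by (simp add: carrier_dist_def add_closed smul_closed)
  qed (auto simp: carrier_dist_def)
next
  fix x y assume xy: "x \<in> W" "y \<in> W"
  have "x = y" if "add x (smul (-1) y) = zero"
  proof -
    have "y = add (add x (smul (-1) y)) y" using that xy by (simp add: add_zero)
    also have "\<dots> = add x (add y (smul (-1) y))"
      using xy by (simp add: add_assoc add_commute smul_closed)
    also have "\<dots> = x"
      using xy by (metis add_smul_minus_one add_commute add_zero zero_closed)
    finally show ?thesis by simp
  qed
  then show "carrier_dist W add smul nrm x y = 0 \<longleftrightarrow> x = y"
    using xy by (auto simp: carrier_dist_def nrm_eq_zero add_closed smul_closed add_smul_minus_one)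
next
  fix x y z assume xyz: "x \<in> W" "y \<in> W" "z \<in> W"
  have "add x (smul (-1) z) = add x (add (add (smul (-1) y) y) (smul (-1) z))"
    using xyz by (metis add_smul_minus_one add_commute add_zero smul_closed)
  also have "\<dots> = add (add x (smul (-1) y)) (add y (smul (-1) z))"
    using xyz by (simp add: add_assoc add_closed smul_closed)
  finally show "carrier_dist W add smul nrm x z
      \<le> carrier_dist W add smul nrm x y + carrier_dist W add smul nrm y z"
    using xyz by (simp add: carrier_dist_def nrm_triangle add_closed smul_closed)
qed

definition compact_operator :: "('a::real_normed_vector \<Rightarrow> 'w) \<Rightarrow> bool"
  where "compact_operator G \<longleftrightarrow>
    range G \<subseteq> W \<and>
    (\<forall>x y. G (x + y) = add (G x) (G y)) \<and>
    (\<forall>a x. G (a *\<^sub>R x) = smul a (G x)) \<and>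
    (let T = Metric_space.mtopology W (carrier_dist W add smul nrm)
     in compactin T (T closure_of (G ` cball 0 1)))"

end

lemma carrier_banach_space_UNIV:
  "carrier_banach_space (UNIV :: 'a::banach set) (+) 0 (*\<^sub>R) norm"
proof -
  have "carrier_dist UNIV (+) (*\<^sub>R) norm = (dist :: 'a \<Rightarrow> 'a \<Rightarrow> real)"
    by (intro ext) (simp add: carrier_dist_def dist_norm)
  then have "Metric_space.mcomplete UNIV (carrier_dist UNIV (+) (*\<^sub>R) (norm :: 'a \<Rightarrow> real))"
    by (simp add: mcomplete_iff_complete complete_UNIV)
  then show ?thesis
    by unfold_locales
      (auto simp: algebra_simps norm_triangle_ineq eq_neg_iff_add_eq_0[symmetric] add.commute
        intro: exI[of _ "- x" for x :: 'a])
qed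

text \<open>The underlying set of \<open>W\<close> ranges over the subsets of this type, where \<open>'w\<close> is
  arbitrary. So every Banach space on a type \<open>'w\<close>, however large, is covered up to isometric
  isomorphism. The summand \<open>real\<close> keeps the type from being too small: for finite \<open>'w\<close> the
  only Banach space carried by a subset of \<open>'w\<close> is the zero space.\<close>

type_synonym 'w universe = "real + 'w"

end

theory Submission
  imports Defs
begin

text \<open>
All five assertions say that \<open>F\<close> is surjective up to finitely many dimensions. The proof passes
through a sixth one, \<open>\<exists>E. finite E \<and> adjoint_bounded_below F E\<close>: the estimate
\<open>norm \<phi> \<le> C * norm (adjoint_op F \<phi>)\<close> holds for all \<open>\<phi>\<close> that vanish on some finite set \<open>E\<close> of vectors
of \<open>X\<close>. Compared with (3), the subspace is an annihilator of vectors of \<open>X\<close> itself, so dualising the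
estimate gives a statement about \<open>X\<close>. Two general theorems do the analytic work.

The first is the open mapping theorem modulo a closed subspace \<open>N\<close> (\<open>open_mapping_modulo\<close>). If \<open>T\<close>
maps \<open>D\<close> onto \<open>S\<close> up to elements of \<open>N\<close>, then every \<open>x\<close> in \<open>S\<close> has the form \<open>T v + n\<close> with \<open>v\<close>
controlled by \<open>x\<close>. Baire's theorem gives this approximately, successive approximation exactly.
Applied to \<open>F\<close> it yields (2) \<open>\<longrightarrow>\<close> (1) and, with \<open>N\<close> spanned by a complement of the range, the sixth
assertion. Its second half alone yields (1) \<open>\<longrightarrow>\<close> (2), because an interior point of the closed convex
hull of \<open>M\<close> is already an approximate version of openness.

The second is the Hahn--Banach theorem (\<open>Hahn_Banach_sublinear\<close>). It turns the estimate on the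
annihilator of \<open>E\<close> into approximability of every \<open>x\<close> by elements \<open>F v + n\<close> with \<open>n\<close> in \<open>span E\<close>, and
successive approximation then shows that the range of \<open>F\<close> and \<open>E\<close> together span \<open>X\<close>. The range is
closed as soon as \<open>E\<close> is chosen such that its annihilator is a complement of the kernel of the
adjoint. Assertion (5) permits this choice (\<open>adjoint_bounded_below_on_complement\<close>) and so implies (2).

The rest is finite-dimensional linear algebra over a closed subspace. Annihilators of finite sets
are closed and of finite codimension, so the sixth assertion implies (3). Under (3) the kernel of
the adjoint meets the subspace trivially and the range is a finite-dimensional extension of a
closed subspace, which is (5). Under (5) the bounded projection onto the kernel has finite rank
and is the compact operator of (4). Under (4), if no finite set \<open>E\<close> worked, one could choose
unit functionals with small adjoint image that stay apart, and their images under the compact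
operator would have no convergent subsequence.
\<close>

section \<open>The Hahn--Banach theorem for sublinear functionals\<close>

text \<open>Positive homogeneity is asked for as an inequality only, which is easier to check for the
  infima below and implies the equality (\<open>sublinear_scale\<close>).\<close>

definition sublinear :: "('a::real_vector \<Rightarrow> real) \<Rightarrow> bool"
  where "sublinear p \<longleftrightarrow>
    (\<forall>x y. p (x + y) \<le> p x + p y) \<and> (\<forall>c x. c > 0 \<longrightarrow> p (c *\<^sub>R x) \<le> c * p x)"

lemma sublinear_add: "sublinear p \<Longrightarrow> p (x + y) \<le> p x + p y"
  by (simp add: sublinear_def)

lemma sublinear_zero: assumes "sublinear p" shows "p 0 = 0"
proof -
  have "p ((1/2) *\<^sub>R 0) \<le> (1/2) * p 0" "p ((2::real) *\<^sub>R 0) \<le> 2 * p 0"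
    using assms unfolding sublinear_def by (metis zero_less_divide_1_iff zero_less_numeral)+
  then show ?thesis by simp
qed

lemma sublinear_scale:
  assumes "sublinear p" "c \<ge> 0"
  shows "p (c *\<^sub>R x) = c * p x"
proof (cases "c = 0")
  case False
  then have c: "c > 0" using assms by simp
  have "p x = p ((1/c) *\<^sub>R (c *\<^sub>R x))" using c by simp
  also have "\<dots> \<le> (1/c) * p (c *\<^sub>R x)"
    using assms c unfolding sublinear_def by (metis zero_less_divide_1_iff)
  finally have "c * p x \<le> p (c *\<^sub>R x)" using c by (simp add: field_simps)
  moreover have "p (c *\<^sub>R x) \<le> c * p x" using assms c by (simp add: sublinear_def)
  ultimately show ?thesis by simp
qed (use sublinear_zero[OF assms(1)] in simp)

lemma sublinear_minus: "sublinear p \<Longrightarrow> - p (- x) \<le> p x"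
  using sublinear_add[of p x "- x"] sublinear_zero[of p] by simp

text \<open>All sublinear functionals needed below are infima of families that are directed in the
  following weak sense.\<close>

lemma sublinear_INF:
  fixes R :: "'i \<Rightarrow> 'a::real_vector \<Rightarrow> real"
  assumes "I \<noteq> {}" and bdd: "\<And>x. bdd_below ((\<lambda>i. R i x) ` I)"
    and add: "\<And>i j x y. i \<in> I \<Longrightarrow> j \<in> I \<Longrightarrow> \<exists>k\<in>I. R k (x + y) \<le> R i x + R j y"
    and scale: "\<And>i c x. i \<in> I \<Longrightarrow> c > 0 \<Longrightarrow> \<exists>k\<in>I. R k (c *\<^sub>R x) \<le> c * R i x"
  shows "sublinear (\<lambda>x. INF i\<in>I. R i x)"
  unfolding sublinear_def
proof (intro conjI allI impI)
  fix x y
  have "(INF i\<in>I. R i (x + y)) - R i x \<le> (INF j\<in>I. R j y)" if i: "i \<in> I" for i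
  proof (rule cINF_greatest[OF \<open>I \<noteq> {}\<close>])
    fix j assume "j \<in> I"
    then obtain k where "k \<in> I" "R k (x + y) \<le> R i x + R j y" using add i by blast
    then show "(INF i\<in>I. R i (x + y)) - R i x \<le> R j y"
      using cINF_lower[OF bdd, of k "x + y"] by simp
  qed
  then have "(INF i\<in>I. R i (x + y)) - (INF j\<in>I. R j y) \<le> R i x" if "i \<in> I" for i
    using that by (smt (verit))
  then have "(INF i\<in>I. R i (x + y)) - (INF j\<in>I. R j y) \<le> (INF i\<in>I. R i x)"
    by (rule cINF_greatest[OF \<open>I \<noteq> {}\<close>])
  then show "(INF i\<in>I. R i (x + y)) \<le> (INF i\<in>I. R i x) + (INF i\<in>I. R i y)" by simp
next
  fix c :: real and x assume c: "c > 0"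
  have "(INF i\<in>I. R i (c *\<^sub>R x)) / c \<le> (INF i\<in>I. R i x)"
  proof (rule cINF_greatest[OF \<open>I \<noteq> {}\<close>])
    fix i assume "i \<in> I"
    then obtain k where "k \<in> I" "R k (c *\<^sub>R x) \<le> c * R i x" using scale c by blast
    then show "(INF i\<in>I. R i (c *\<^sub>R x)) / c \<le> R i x"
      using cINF_lower[OF bdd, of k "c *\<^sub>R x"] c by (simp add: field_simps)
  qed
  then show "(INF i\<in>I. R i (c *\<^sub>R x)) \<le> c * (INF i\<in>I. R i x)"
    using c by (simp add: field_simps)
qed

text \<open>A sublinear functional can be lowered until it is additive in a given direction \<open>y\<close>: follow
  the ray from \<open>x\<close> in direction \<open>y\<close>, paying \<open>p y\<close> per unit.\<close>

lemma sublinear_lower_along: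
  assumes p: "sublinear p"
  obtains q where "sublinear q" "\<And>x. q x \<le> p x" "\<And>x. q x \<le> p (x + y) - p y"
proof
  let ?R = "\<lambda>t x. p (x + t *\<^sub>R y) - t * p y"
  define q where "q = (\<lambda>x. INF t\<in>{0..}. ?R t x)"
  have bdd: "bdd_below ((\<lambda>t. ?R t x) ` {0..})" for x
  proof (rule bdd_belowI2)
    fix t :: real assume "t \<in> {0..}"
    then show "- p (- x) \<le> ?R t x"
      using sublinear_add[OF p, of "x + t *\<^sub>R y" "- x"] sublinear_scale[OF p, of t y] by simp
  qed
  show "sublinear q" unfolding q_def
  proof (rule sublinear_INF[OF _ bdd])
    fix s t :: real and x z assume st: "s \<in> {0..}" "t \<in> {0..}"
    have "?R (s + t) (x + z) \<le> ?R s x + ?R t z"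
      using sublinear_add[OF p, of "x + s *\<^sub>R y" "z + t *\<^sub>R y"]
      by (simp add: algebra_simps)
    then show "\<exists>k\<in>{0..}. ?R k (x + z) \<le> ?R s x + ?R t z"
      using st by (intro bexI[of _ "s + t"]) auto
  next
    fix t c :: real and x assume tc: "t \<in> {0..}" "c > 0"
    have "?R (c * t) (c *\<^sub>R x) \<le> c * ?R t x"
      using sublinear_scale[OF p, of c "x + t *\<^sub>R y"] tc by (simp add: algebra_simps)
    then show "\<exists>k\<in>{0..}. ?R k (c *\<^sub>R x) \<le> c * ?R t x"
      using tc by (intro bexI[of _ "c * t"]) auto
  qed simp
  have "q x \<le> ?R t x" if "t \<ge> 0" for t x
    unfolding q_def using that by (intro cINF_lower[OF bdd]) simp
  from this[of 0] this[of 1] show "q x \<le> p x" "q x \<le> p (x + y) - p y" for x by simp_all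
qed

text \<open>Zorn's lemma: a chain of sublinear functionals below \<open>p\<close> has its pointwise infimum as a lower
  bound, which is finite because all members stay above \<open>\<lambda>x. - p (- x)\<close>.\<close>

lemma minimal_sublinear_exists:
  assumes p: "sublinear p"
  obtains m where "sublinear m" "\<And>x. m x \<le> p x"
    "\<And>q x. sublinear q \<Longrightarrow> (\<And>y. q y \<le> m y) \<Longrightarrow> q x = m x"
proof -
  define A where "A = {q. sublinear q \<and> (\<forall>x. q x \<le> p x)}"
  define P :: "('a \<Rightarrow> real) \<Rightarrow> ('a \<Rightarrow> real) \<Rightarrow> bool" where "P = (\<lambda>f g. \<forall>x. g x \<le> f x)"
  have "\<exists>m\<in>A. \<forall>a\<in>A. P m a \<longrightarrow> a = m"
  proof (rule predicate_Zorn)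
    show "partial_order_on A (relation_of P A)"
    proof (rule partial_order_on_relation_ofI)
      show "a = b" if "P a b" "P b a" for a b
        using that unfolding P_def by (intro ext) (simp add: order_antisym)
    qed (auto simp: P_def intro: order_trans)
    fix C assume C: "C \<in> Chains (relation_of P A)"
    have CA: "C \<subseteq> A" using Chains_relation_of[OF C] .
    have total: "P f g \<or> P g f" if "f \<in> C" "g \<in> C" for f g
      using C that unfolding Chains_def relation_of_def by auto
    show "\<exists>u\<in>A. \<forall>a\<in>C. P a u"
    proof (cases "C = {}")
      case True
      then show ?thesis using p by (auto simp: A_def)
    next
      case False
      have bdd: "bdd_below ((\<lambda>q. q x) ` C)" for x
      proof (rule bdd_belowI2)
        fix q assume "q \<in> C"
        then have "sublinear q" "q (- x) \<le> p (- x)" using CA by (auto simp: A_def)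
        then show "- p (- x) \<le> q x" using sublinear_minus[of q x] by simp
      qed
      let ?u = "\<lambda>x. INF q\<in>C. q x"
      have "sublinear ?u"
      proof (rule sublinear_INF[OF False bdd])
        fix f g x y assume fg: "f \<in> C" "g \<in> C"
        then have "sublinear f" "sublinear g" using CA by (auto simp: A_def)
        then have "f (x + y) \<le> f x + f y" "g (x + y) \<le> g x + g y"
          by (simp_all add: sublinear_add)
        then show "\<exists>k\<in>C. k (x + y) \<le> f x + g y"
          using total[OF fg] fg unfolding P_def by (smt (verit))
      next
        fix f c x assume "f \<in> C" "(c::real) > 0"
        then show "\<exists>k\<in>C. k (c *\<^sub>R x) \<le> c * f x"
          using CA by (intro bexI[of _ f]) (auto simp: A_def sublinear_def)
      qed
      moreover have low: "?u x \<le> q x" if "q \<in> C" for q x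
        using cINF_lower[OF bdd that] .
      moreover have "?u x \<le> p x" for x
      proof -
        obtain q where "q \<in> C" using False by blast
        moreover have "q x \<le> p x" using \<open>q \<in> C\<close> CA by (auto simp: A_def)
        ultimately show ?thesis using low order_trans by blast
      qed
      ultimately show ?thesis by (intro bexI[of _ ?u]) (auto simp: P_def A_def)
    qed
  qed
  then obtain m where m: "m \<in> A" "\<And>a. a \<in> A \<Longrightarrow> P m a \<Longrightarrow> a = m" by blast
  have "q x = m x" if q: "sublinear q" "\<And>y. q y \<le> m y" for q x
  proof -
    have "q y \<le> p y" for y using q(2)[of y] m(1) order_trans by (auto simp: A_def)
    then have "q \<in> A" "P m q" using q by (auto simp: A_def P_def)
    then have "q = m" by (rule m(2))
    then show ?thesis by simp
  qed
  with m(1) show thesis by (intro that[of m]) (auto simp: A_def)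
qed

text \<open>A minimal sublinear functional cannot be lowered along any direction, so it is linear. This
  replaces the usual one-dimensional extension step. To reach the prescribed value at \<open>x0\<close>, first
  lower \<open>p\<close> along \<open>x0\<close>, which forces \<open>f (- x0) \<le> - p x0\<close>.\<close>

theorem Hahn_Banach_sublinear:
  fixes p :: "'a::real_vector \<Rightarrow> real"
  assumes p: "sublinear p"
  obtains f where "linear f" "\<And>x. f x \<le> p x" "f x0 = p x0"
proof -
  obtain q where q: "sublinear q" "\<And>x. q x \<le> p x" "\<And>x. q x \<le> p (x + x0) - p x0"
    using sublinear_lower_along[OF p] by blast
  obtain f where f: "sublinear f" "\<And>x. f x \<le> q x"
    "\<And>q x. sublinear q \<Longrightarrow> (\<And>y. q y \<le> f y) \<Longrightarrow> q x = f x"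
    using minimal_sublinear_exists[OF q(1)] by blast
  have add: "f (x + y) = f x + f y" for x y
  proof -
    obtain r where "sublinear r" "\<And>x. r x \<le> f x" "\<And>x. r x \<le> f (x + y) - f y"
      using sublinear_lower_along[OF f(1)] by blast
    then have "f x \<le> f (x + y) - f y" using f(3) by metis
    then show ?thesis using sublinear_add[OF f(1), of x y] by simp
  qed
  have minus: "f (- x) = - f x" for x
    using add[of x "- x"] sublinear_zero[OF f(1)] by simp
  have "f (c *\<^sub>R x) = c *\<^sub>R f x" for c x
    using sublinear_scale[OF f(1), of c x] sublinear_scale[OF f(1), of "- c" x]
      minus[of "c *\<^sub>R x"]
    by (cases "c \<ge> 0") simp_all
  then have "linear f" using add by (intro linearI) auto
  moreover have "f x \<le> p x" for x using f(2) q(2) order_trans by blast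
  moreover have "f (- x0) \<le> - p x0"
    using f(2)[of "- x0"] q(3)[of "- x0"] sublinear_zero[OF p] by simp
  ultimately show thesis using that[of f] minus[of x0] by (simp add: order_antisym)
qed

lemma blinfun_from_linear_le:
  fixes f :: "'a::real_normed_vector \<Rightarrow> real"
  assumes f: "linear f" and le: "\<And>x. f x \<le> K * norm x"
  obtains \<phi> :: "'a \<Rightarrow>\<^sub>L real" where "blinfun_apply \<phi> = f"
proof -
  have "norm (f x) \<le> norm x * K" for x
    using le[of x] le[of "- x"] linear_neg[OF f, of x] by (simp add: mult.commute)
  then have "bounded_linear f"
    using f by (intro bounded_linear_intro[of f K]) (auto simp: linear_add linear_scale)
  then show thesis using that by (metis bounded_linear_Blinfun_apply)
qed

lemma sublinear_norm: "sublinear (norm :: 'a::real_normed_vector \<Rightarrow> real)"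
  by (simp add: sublinear_def norm_triangle_ineq)

corollary functionals_separate_points:
  fixes x :: "'a::real_normed_vector"
  assumes "\<And>\<phi> :: 'a \<Rightarrow>\<^sub>L real. blinfun_apply \<phi> x = 0"
  shows "x = 0"
proof -
  obtain f where f: "linear f" "\<And>y. f y \<le> norm y" "f x = norm x"
    using Hahn_Banach_sublinear[OF sublinear_norm] by blast
  obtain \<phi> :: "'a \<Rightarrow>\<^sub>L real" where "blinfun_apply \<phi> = f"
    using blinfun_from_linear_le[OF f(1), of 1] f(2) by auto
  then show ?thesis using assms[of \<phi>] f(3) by simp
qed

section \<open>The open mapping theorem modulo a subspace\<close>

lemma subspace_image_add:
  assumes "linear T" "subspace D" "subspace N"
  shows "subspace {T v + n | v n. v \<in> D \<and> n \<in> N}"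
proof -
  have "{T v + n | v n. v \<in> D \<and> n \<in> N} = {y + n | y n. y \<in> T ` D \<and> n \<in> N}" by auto
  then show ?thesis
    using subspace_sums[OF linear_subspace_image[OF assms(1,2)] assms(3)] by simp
qed

text \<open>Successive approximation: the remainders are halved at every step, so the corrections in
  \<open>D\<close> are summable, and what remains in the limit is a limit of elements of \<open>N\<close>.\<close>

lemma almost_open_imp_open:
  fixes T :: "'a::banach \<Rightarrow> 'b::real_normed_vector"
  assumes T: "bounded_linear T" and D: "subspace D" "closed D" and N: "subspace N" "closed N"
    and S: "subspace S" "T ` D \<subseteq> S" "N \<subseteq> S" and c: "c \<ge> 0"
    and approx: "\<And>x e. x \<in> S \<Longrightarrow> e > 0 \<Longrightarrow>
      \<exists>v\<in>D. \<exists>n\<in>N. norm v \<le> c * norm x \<and> norm (x - T v - n) \<le> e"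
    and x: "x \<in> S"
  shows "\<exists>v\<in>D. norm v \<le> 2 * c * norm x \<and> x - T v \<in> N"
proof (cases "x = 0")
  case True
  then show ?thesis
    using subspace_0[OF D(1)] subspace_0[OF N(1)]
    by (intro bexI[of _ 0]) (auto simp: linear_simps[OF T])
next
  case False
  interpret T: bounded_linear T by fact
  have "\<exists>v\<in>D. \<exists>n\<in>N. norm v \<le> c * norm y \<and> norm (y - T v - n) \<le> e" if "y \<in> S" "e > 0" for y e
    using approx that by blast
  then obtain V U where V: "\<And>y e. y \<in> S \<Longrightarrow> e > 0 \<Longrightarrow> V y e \<in> D \<and> U y e \<in> N \<and>
      norm (V y e) \<le> c * norm y \<and> norm (y - T (V y e) - U y e) \<le> e"
    by metis
  define e where "e k = norm x / 2 ^ Suc k" for k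
  have e: "e k > 0" for k using False by (simp add: e_def)
  define y where "y = rec_nat x (\<lambda>k z. z - T (V z (e k)) - U z (e k))"
  have y0: "y 0 = x" and ySuc: "y (Suc k) = y k - T (V (y k) (e k)) - U (y k) (e k)" for k
    by (simp_all add: y_def)
  have yS: "y k \<in> S" for k
  proof (induction k)
    case (Suc k)
    then have "T (V (y k) (e k)) \<in> S" "U (y k) (e k) \<in> S" using V[of "y k" "e k"] e S by auto
    then show ?case using Suc S(1) by (simp add: ySuc subspace_diff)
  qed (simp add: y0 x)
  define v u where "v k = V (y k) (e k)" and "u k = U (y k) (e k)" for k
  have vu: "v k \<in> D" "u k \<in> N" "norm (v k) \<le> c * norm (y k)" "norm (y (Suc k)) \<le> e k" for k
    using V[OF yS e] by (auto simp: v_def u_def ySuc)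
  have ny: "norm (y k) \<le> norm x * (1/2) ^ k" for k
    using vu(4)[of "k - 1"] by (cases k) (auto simp: y0 e_def power_one_over divide_simps)
  have nv: "norm (v k) \<le> c * norm x * (1/2) ^ k" for k
    using mult_left_mono[OF ny c, of k] vu(3)[of k] by (simp add: mult.assoc)
  have geo: "(\<lambda>k. c * norm x * (1/2) ^ k) sums (c * norm x * 2)"
    using sums_mult[OF geometric_sums[of "1/2::real"], of "c * norm x"] by simp
  have sv: "summable (\<lambda>k. norm (v k))"
    by (rule summable_comparison_test'[OF sums_summable[OF geo], of 0]) (simp add: nv)
  define w where "w = suminf v"
  have lim: "(\<lambda>m. \<Sum>k<m. v k) \<longlonglongrightarrow> w"
    using summable_norm_cancel[OF sv] unfolding w_def by (rule summable_LIMSEQ)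
  have wD: "w \<in> D"
    by (rule closed_sequentially[OF D(2) _ lim]) (simp add: subspace_sum D(1) vu)
  have "norm w \<le> (\<Sum>k. norm (v k))" unfolding w_def by (rule summable_norm[OF sv])
  also have "\<dots> \<le> c * norm x * 2"
    using suminf_le[OF nv sv sums_summable[OF geo]] sums_unique[OF geo] by simp
  finally have nw: "norm w \<le> 2 * c * norm x" by (simp add: mult_ac)
  have ysum: "x - T (\<Sum>k<m. v k) - y m = (\<Sum>k<m. u k)" for m
    by (induction m) (simp_all add: y0 ySuc T.add T.zero v_def u_def algebra_simps)
  have "(\<lambda>k. norm x * (1/2::real) ^ k) \<longlonglongrightarrow> 0"
    using tendsto_mult_right_zero[OF LIMSEQ_realpow_zero[of "1/2::real"]] by simp
  then have "y \<longlonglongrightarrow> 0" by (rule tendsto_0_le[where K = 1]) (simp add: ny)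
  then have "(\<lambda>m. x - T (\<Sum>k<m. v k) - y m) \<longlonglongrightarrow> x - T w - 0"
    by (intro tendsto_diff tendsto_const T.tendsto lim)
  then have "(\<lambda>m. \<Sum>k<m. u k) \<longlonglongrightarrow> x - T w" by (simp add: ysum)
  then have "x - T w \<in> N"
    by (rule closed_sequentially[OF N(2), rotated]) (simp add: subspace_sum N(1) vu)
  with wD nw show ?thesis by blast
qed

text \<open>Differences of elements of \<open>A\<close> approximate a ball around the origin, with twice the bound on
  \<open>v\<close>. Scaling does the rest.\<close>

lemma dense_in_ball_imp_almost_open:
  fixes T :: "'a::real_normed_vector \<Rightarrow> 'b::real_normed_vector"
  assumes T: "linear T" and D: "subspace D" and N: "subspace N" and S: "subspace S"
    and A: "A = {T v + n | v n. v \<in> D \<and> n \<in> N \<and> norm v \<le> k}"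
    and x0: "x0 \<in> S" and r: "r > 0" "\<And>y. y \<in> S \<Longrightarrow> dist y x0 < r \<Longrightarrow> y \<in> closure A"
  obtains c where "c > 0" "\<And>x e. x \<in> S \<Longrightarrow> e > 0 \<Longrightarrow>
      \<exists>v\<in>D. \<exists>n\<in>N. norm v \<le> c * norm x \<and> norm (x - T v - n) \<le> e"
proof -
  interpret T: linear T by fact
  have small: "\<exists>v\<in>D. \<exists>n\<in>N. norm v \<le> 2 * k \<and> norm (x - T v - n) \<le> e"
    if x: "x \<in> S" "norm x < r" and e: "e > 0" for x e
  proof -
    have "x0 + x \<in> closure (A)" "x0 \<in> closure (A)"
      using r x x0 subspace_add[OF S] by (auto simp: dist_norm)
    then obtain a b where ab: "a \<in> A" "dist a (x0 + x) < e/2" "b \<in> A" "dist b x0 < e/2"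
      using e half_gt_zero[OF e] unfolding closure_approachable by blast
    then obtain v n v' n' where *: "a = T v + n" "v \<in> D" "n \<in> N" "norm v \<le> k"
        "b = T v' + n'" "v' \<in> D" "n' \<in> N" "norm v' \<le> k"
      unfolding A by blast
    have "norm (x - T (v - v') - (n - n')) = norm ((x0 + x - a) - (x0 - b))"
      using * by (simp add: T.diff algebra_simps)
    also have "\<dots> \<le> norm (x0 + x - a) + norm (x0 - b)" by (rule norm_triangle_ineq4)
    also have "\<dots> \<le> e" using ab by (simp add: dist_norm norm_minus_commute)
    finally show ?thesis
      using * norm_triangle_ineq4[of v v']
      by (intro bexI[of _ "v - v'"] bexI[of _ "n - n'"])
        (auto intro: subspace_diff[OF D] subspace_diff[OF N])
  qed
  \<comment> \<open>The summand 1 only serves to make the constant positive.\<close>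
  define c where "c = 4 * k / r + 1"
  have "\<exists>v\<in>D. \<exists>n\<in>N. norm v \<le> c * norm x \<and> norm (x - T v - n) \<le> e"
    if x: "x \<in> S" and e: "e > 0" for x e
  proof (cases "x = 0")
    case True
    then show ?thesis using e subspace_0[OF D] subspace_0[OF N]
      by (intro bexI[of _ 0]) (auto simp: T.zero)
  next
    case False
    define t where "t = r / (2 * norm x)"
    have t: "t > 0" "norm (t *\<^sub>R x) < r" using r False by (auto simp: t_def)
    obtain v n where vn: "v \<in> D" "n \<in> N" "norm v \<le> 2 * k"
        "norm (t *\<^sub>R x - T v - n) \<le> t * e"
      using small[OF subspace_scale[OF S x] t(2), of "t * e"] t e by auto
    have "x - T (v /\<^sub>R t) - n /\<^sub>R t = (t *\<^sub>R x - T v - n) /\<^sub>R t"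
      using t by (simp add: T.scaleR scaleR_diff_right)
    then have "norm (x - T (v /\<^sub>R t) - n /\<^sub>R t) = norm (t *\<^sub>R x - T v - n) / t"
      using t by (simp add: divide_inverse_commute)
    then have 1: "norm (x - T (v /\<^sub>R t) - n /\<^sub>R t) \<le> e"
      using vn t by (simp only: pos_divide_le_eq) (simp add: mult.commute)
    have "norm (v /\<^sub>R t) \<le> 2 * k / t" using vn t by (simp add: field_simps)
    also have "\<dots> \<le> c * norm x" using r False by (simp add: t_def c_def field_simps)
    finally show ?thesis using 1 vn
      by (intro bexI[of _ "v /\<^sub>R t"] bexI[of _ "n /\<^sub>R t"])
        (auto intro: subspace_scale[OF D] subspace_scale[OF N])
  qed
  moreover
  have "k \<ge> 0"
  proof -
    have "x0 \<in> closure A" using r x0 by simp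
    then have "A \<noteq> {}" by auto
    then obtain v :: 'a where "norm v \<le> k" unfolding A by blast
    then show ?thesis using norm_ge_zero[of v] by linarith
  qed
  then have "c > 0" using r(1) by (simp add: c_def add_nonneg_pos)
  ultimately show thesis using that by blast
qed

text \<open>The countably many sets \<open>A k\<close> of the proof cover \<open>S\<close>, so by Baire's theorem one of them is
  dense in a ball of \<open>S\<close>.\<close>

lemma surjective_imp_almost_open:
  fixes T :: "'a::real_normed_vector \<Rightarrow> 'b::banach"
  assumes T: "linear T" and D: "subspace D" and N: "subspace N"
    and S: "closed S" "S = {T v + n | v n. v \<in> D \<and> n \<in> N}"
  obtains c where "c > 0" "\<And>x e. x \<in> S \<Longrightarrow> e > 0 \<Longrightarrow>
      \<exists>v\<in>D. \<exists>n\<in>N. norm v \<le> c * norm x \<and> norm (x - T v - n) \<le> e"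
proof -
  interpret T: linear T by fact
  define A where "A k = {T v + n | v n. v \<in> D \<and> n \<in> N \<and> norm v \<le> real k}" for k :: nat
  have subS: "subspace S" unfolding S(2) by (rule subspace_image_add[OF assms(1-3)])
  note S0 = subspace_0[OF subS]
  have clA: "closure (A k) \<subseteq> S" for k
    by (rule closure_minimal[OF _ S(1)]) (auto simp: A_def S(2))
  have cover: "(\<Union>k. closure (A k)) = S"
  proof
    show "S \<subseteq> (\<Union>k. closure (A k))"
    proof
      fix x assume "x \<in> S"
      then obtain v n where "x = T v + n" "v \<in> D" "n \<in> N" unfolding S(2) by blast
      then have "x \<in> A (nat \<lceil>norm v\<rceil>)" 
        unfolding A_def using real_nat_ceiling_ge[of "norm v"] by blast
      then show "x \<in> (\<Union>k. closure (A k))" using closure_subset by blast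
    qed
  qed (use clA in blast)
  have "\<exists>k. (top_of_set S) interior_of (closure (A k)) \<noteq> {}"
  proof (rule ccontr)
    assume "\<not> ?thesis"
    then have none: "(top_of_set S) interior_of (closure (A k)) = {}" for k by blast
    have "completely_metrizable_space (top_of_set S)"
      using S(1) completely_metrizable_space_closedin completely_metrizable_space_euclidean
        closed_closedin by blast
    then have "(top_of_set S) interior_of (\<Union> (range (\<lambda>k. closure (A k)))) = {}"
      using none closed_subset[OF clA closed_closure] 
      by (intro Baire_category_alt) (simp_all, blast?)
    moreover have "(top_of_set S) interior_of S = S"
      by (metis interior_of_topspace topspace_euclidean_subtopology)
    ultimately show False using cover S0 by auto
  qed
  then obtain k x0 where x0: "x0 \<in> (top_of_set S) interior_of (closure (A k))" by blast
  moreover have sub: "(top_of_set S) interior_of (closure (A k)) \<subseteq> closure (A k)"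
    by (rule interior_of_subset)
  ultimately have x0S: "x0 \<in> S" using clA by blast
  have "openin (top_of_set S) ((top_of_set S) interior_of (closure (A k)))" by simp
  then obtain r where "r > 0"
    "\<forall>y\<in>S. dist y x0 < r \<longrightarrow> y \<in> (top_of_set S) interior_of (closure (A k))"
    using x0 unfolding openin_euclidean_subtopology_iff by blast
  then have r: "r > 0" "\<And>y. y \<in> S \<Longrightarrow> dist y x0 < r \<Longrightarrow> y \<in> closure (A k)"
    using sub by auto
  show thesis
    by (rule dense_in_ball_imp_almost_open[OF assms(1-3) subS A_def x0S r]) (assumption+, rule that)
qed

theorem open_mapping_modulo:
  fixes T :: "'a::banach \<Rightarrow> 'b::banach"
  assumes T: "bounded_linear T" and D: "subspace D" "closed D" and N: "subspace N" "closed N"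
    and S: "closed S" "S = {T v + n | v n. v \<in> D \<and> n \<in> N}"
  obtains c where "c > 0" "\<And>x. x \<in> S \<Longrightarrow> \<exists>v\<in>D. norm v \<le> c * norm x \<and> x - T v \<in> N"
proof -
  interpret T: bounded_linear T by fact
  obtain c where c: "c > 0" "\<And>x e. x \<in> S \<Longrightarrow> e > 0 \<Longrightarrow>
      \<exists>v\<in>D. \<exists>n\<in>N. norm v \<le> c * norm x \<and> norm (x - T v - n) \<le> e"
    using surjective_imp_almost_open[OF T.linear_axioms D(1) N(1) S] by blast
  have "subspace S"
    unfolding S(2) by (rule subspace_image_add[OF T.linear_axioms D(1) N(1)])
  moreover have "T ` D \<subseteq> S" "N \<subseteq> S"
    unfolding S(2) using subspace_0[OF D(1)] subspace_0[OF N(1)] T.zero by force+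
  ultimately have "\<exists>v\<in>D. norm v \<le> 2 * c * norm x \<and> x - T v \<in> N" if "x \<in> S" for x
    using almost_open_imp_open[OF T D N] c that by auto
  with c(1) show thesis using that[of "2 * c"] by auto
qed

corollary open_mapping_range:
  fixes T :: "'a::banach \<Rightarrow> 'b::banach"
  assumes T: "bounded_linear T" and D: "subspace D" "closed D" and cl: "closed (T ` D)"
  obtains c where "c > 0" "\<And>x. x \<in> T ` D \<Longrightarrow> \<exists>v\<in>D. norm v \<le> c * norm x \<and> T v = x"
proof -
  obtain c where "c > 0" "\<And>x. x \<in> T ` D \<Longrightarrow> \<exists>v\<in>D. norm v \<le> c * norm x \<and> x - T v \<in> {0}"
    by (rule open_mapping_modulo[OF T D, of "{0}" "T ` D"]) (use cl subspace_single_0 in auto)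
  then show thesis using that by fastforce
qed

section \<open>Finite-dimensional extensions of subspaces\<close>

text \<open>Here \<open>d\<close> is a lower bound for the distance from \<open>b\<close> to \<open>S\<close>. The bound makes the coefficient
  along \<open>b\<close> a continuous function of the vector, which is what the next lemmas use.\<close>

lemma norm_add_line_ge:
  fixes S :: "'a::real_normed_vector set"
  assumes S: "subspace S" "closed S" and b: "b \<notin> S"
  obtains d where "d > 0" "\<And>s t. s \<in> S \<Longrightarrow> d * \<bar>t\<bar> \<le> norm (s + t *\<^sub>R b)"
proof -
  obtain d where d: "d > 0" "ball b d \<subseteq> - S"
    using S(2) b by (meson ComplI open_Compl open_contains_ball)
  have "d * \<bar>t\<bar> \<le> norm (s + t *\<^sub>R b)" if s: "s \<in> S" for s t
  proof (cases "t = 0")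
    case False
    have "- (s /\<^sub>R t) \<in> S" using s S(1) by (simp add: subspace_neg subspace_scale)
    then have "d \<le> dist b (- (s /\<^sub>R t))" using d(2) by force
    also have "\<dots> = norm ((s + t *\<^sub>R b) /\<^sub>R t)"
      using False by (simp add: dist_norm scaleR_add_right algebra_simps)
    also have "\<dots> = norm (s + t *\<^sub>R b) / \<bar>t\<bar>" by (simp add: divide_inverse_commute)
    finally show ?thesis using False by (simp add: field_simps)
  qed simp
  with d(1) show thesis using that by blast
qed

lemma closed_span_insert:
  fixes S :: "'a::real_normed_vector set"
  assumes cl: "closed (span S)"
  shows "closed (span (insert b S))"
proof (cases "b \<in> span S")
  case True
  then show ?thesis using cl by (simp add: span_redundant)
next
  case False
  obtain d where d: "d > 0" "\<And>s t. s \<in> span S \<Longrightarrow> d * \<bar>t\<bar> \<le> norm (s + t *\<^sub>R b)"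
    using norm_add_line_ge[OF subspace_span cl False] by blast
  show ?thesis
    unfolding closed_sequential_limits
  proof (intro allI impI, elim conjE)
    fix z l assume "\<forall>n::nat. z n \<in> span (insert b S)" and l: "z \<longlonglongrightarrow> l"
    then obtain t where t: "\<And>n. z n - t n *\<^sub>R b \<in> span S" unfolding span_insert by auto metis
    have td: "d * \<bar>t m - t n\<bar> \<le> norm (z m - z n)" for m n
      using d(2)[OF span_diff[OF t[of m] t[of n]], of "t m - t n"] by (simp add: algebra_simps)
    have "Cauchy t" unfolding Cauchy_def
    proof (intro allI impI)
      fix e :: real assume "e > 0"
      then have "d * e > 0" using d(1) by simp
      then obtain N where "\<forall>m\<ge>N. \<forall>n\<ge>N. dist (z m) (z n) < d * e"
        using LIMSEQ_imp_Cauchy[OF l] unfolding Cauchy_def by meson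
      then have "d * \<bar>t m - t n\<bar> < d * e" if "m \<ge> N" "n \<ge> N" for m n
        using that td[of m n] by (force simp: dist_norm)
      then show "\<exists>N. \<forall>m\<ge>N. \<forall>n\<ge>N. dist (t m) (t n) < e"
        using d(1) by (auto simp: dist_norm)
    qed
    then obtain r where "t \<longlonglongrightarrow> r" using Cauchy_convergent convergent_def by blast
    then have "(\<lambda>n. z n - t n *\<^sub>R b) \<longlonglongrightarrow> l - r *\<^sub>R b" using l by (intro tendsto_intros)
    then have "l - r *\<^sub>R b \<in> span S" 
      by (rule closed_sequentially[OF cl t])
    then show "l \<in> span (insert b S)" unfolding span_insert by blast
  qed
qed

lemma closed_span_Un_finite:
  fixes S :: "'a::real_normed_vector set"
  assumes "finite B" "closed (span S)"
  shows "closed (span (S \<union> B))"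
  using assms by induction (simp_all add: closed_span_insert)

lemma closed_span_finite:
  fixes B :: "'a::real_normed_vector set"
  shows "finite B \<Longrightarrow> closed (span B)"
  using closed_span_Un_finite[of B "{}"] by simp

lemma compact_cball_Int_span_finite:
  fixes B :: "'a::real_normed_vector set"
  assumes "finite B"
  shows "compact (cball 0 r \<inter> span B)"
  using assms
proof (induction B arbitrary: r)
  case empty
  have "cball 0 r \<inter> span {} \<subseteq> {0::'a}" by simp
  then have "finite (cball 0 r \<inter> span {} :: 'a set)" using finite_subset by blast
  then show ?case by (rule finite_imp_compact)
next
  case (insert b B)
  show ?case
  proof (cases "b \<in> span B")
    case True
    then show ?thesis using insert.IH by (simp add: span_redundant)
  next
    case False
    obtain d where d: "d > 0" "\<And>s t. s \<in> span B \<Longrightarrow> d * \<bar>t\<bar> \<le> norm (s + t *\<^sub>R b)"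
      using norm_add_line_ge[OF subspace_span closed_span_finite[OF insert.hyps(1)] False] by blast
    define Q where "Q = r + r / d * norm b"
    let ?C = "(\<lambda>(t, s). s + t *\<^sub>R b) ` ({- (r/d)..r/d} \<times> (cball 0 Q \<inter> span B))"
    have "compact ?C"
      using insert.IH
      by (intro compact_continuous_image compact_Times)
        (auto simp: split_beta intro!: continuous_intros)
    moreover have "closed (cball 0 r \<inter> span (insert b B))"
      using insert.hyps by (intro closed_Int closed_span_finite) auto
    moreover have "cball 0 r \<inter> span (insert b B) \<subseteq> ?C"
    proof
      fix z assume z: "z \<in> cball 0 r \<inter> span (insert b B)"
      then obtain t where t: "z - t *\<^sub>R b \<in> span B" unfolding span_insert by blast
      have "d * \<bar>t\<bar> \<le> r" using d(2)[OF t, of t] z by simp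
      then have tr: "\<bar>t\<bar> \<le> r / d" using d(1) by (simp add: field_simps)
      have "norm (z - t *\<^sub>R b) \<le> norm z + \<bar>t\<bar> * norm b"
        by (metis norm_scaleR norm_triangle_ineq4)
      also have "\<dots> \<le> Q" using z mult_right_mono[OF tr norm_ge_zero[of b]] by (simp add: Q_def)
      finally have "z - t *\<^sub>R b \<in> cball 0 Q \<inter> span B" using t by simp
      then show "z \<in> ?C" using tr by (intro image_eqI[of _ _ "(t, z - t *\<^sub>R b)"]) (auto simp: abs_le_iff)
    qed
    ultimately show ?thesis by (metis compact_Int_closed inf.absorb_iff2)
  qed
qed

text \<open>Adding one vector to a subspace raises the dimension of its intersection with \<open>K\<close> by at
  most one.\<close>

lemma subspace_Int_span_Un_finite:
  fixes K :: "'a::real_vector set"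
  assumes K: "subspace K" and "finite B" and "\<exists>A. finite A \<and> K \<inter> span Y = span A"
  shows "\<exists>A. finite A \<and> K \<inter> span (Y \<union> B) = span A"
  using assms(2,3)
proof (induction B)
  case (insert b B)
  then obtain A where A: "finite A" "K \<inter> span (Y \<union> B) = span A" by auto
  let ?Z = "span (Y \<union> B)" and ?Z' = "span (insert b (Y \<union> B))"
  have mono: "?Z \<subseteq> ?Z'" by (intro span_mono) auto
  show ?case
  proof (cases "K \<inter> ?Z' \<subseteq> ?Z")
    case True
    then have "K \<inter> ?Z' = span A" using A mono by blast
    then show ?thesis using A(1) by auto
  next
    case False
    then obtain k0 where k0: "k0 \<in> K" "k0 \<in> ?Z'" "k0 \<notin> ?Z" by blast
    then obtain t0 where t0: "k0 - t0 *\<^sub>R b \<in> ?Z" unfolding span_insert by blast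
    then have "t0 \<noteq> 0" using k0(3) by auto
    have "K \<inter> ?Z' = span (insert k0 A)"
    proof
      show "span (insert k0 A) \<subseteq> K \<inter> ?Z'"
        using k0 A mono span_superset[of A] K
        by (intro span_minimal subspace_inter subspace_span) auto
      show "K \<inter> ?Z' \<subseteq> span (insert k0 A)"
      proof
        fix z assume z: "z \<in> K \<inter> ?Z'"
        then obtain t where t: "z - t *\<^sub>R b \<in> ?Z" unfolding span_insert by blast
        have "z - (t / t0) *\<^sub>R k0 = (z - t *\<^sub>R b) - (t / t0) *\<^sub>R (k0 - t0 *\<^sub>R b)"
          using \<open>t0 \<noteq> 0\<close> by (simp add: algebra_simps)
        also have "\<dots> \<in> ?Z" by (rule span_diff[OF t span_scale[OF t0]])
        finally have "z - (t / t0) *\<^sub>R k0 \<in> span A"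
          using A z k0 K by (auto intro: subspace_diff subspace_scale)
        then show "z \<in> span (insert k0 A)" unfolding span_insert by blast
      qed
    qed
    then show ?thesis using A(1) by (intro exI[of _ "insert k0 A"]) auto
  qed
qed simp

text \<open>A vector is coded by its coefficient along \<open>b\<close> and the code of the remainder, and
  \<open>real \<times> real\<close> injects into \<open>real\<close>. The reals are the part of \<open>'w universe\<close> that is there for
  every \<open>'w\<close>.\<close>

lemma inj_on_span_finite_real:
  fixes B :: "'a::real_vector set"
  assumes "finite B"
  shows "\<exists>h :: 'a \<Rightarrow> real. inj_on h (span B)"
  using assms
proof induction
  case (insert b B)
  then obtain h :: "'a \<Rightarrow> real" where h: "inj_on h (span B)" by blast
  obtain g :: "real \<times> real \<Rightarrow> real" where g: "inj g"
    using card_of_Times_same_infinite[OF infinite_UNIV_char_0[where 'a = real]]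
    unfolding card_of_ordIso[symmetric] bij_betw_def by auto
  have "\<forall>x\<in>span (insert b B). \<exists>k. x - k *\<^sub>R b \<in> span B" by (simp add: span_insert)
  then obtain k where k: "\<And>x. x \<in> span (insert b B) \<Longrightarrow> x - k x *\<^sub>R b \<in> span B" by metis
  have "inj_on (\<lambda>x. g (k x, h (x - k x *\<^sub>R b))) (span (insert b B))"
  proof (rule inj_onI)
    fix x y assume xy: "x \<in> span (insert b B)" "y \<in> span (insert b B)"
      and "g (k x, h (x - k x *\<^sub>R b)) = g (k y, h (y - k y *\<^sub>R b))"
    then have "k x = k y" "h (x - k x *\<^sub>R b) = h (y - k y *\<^sub>R b)" using g by (auto dest: injD)
    then show "x = y" using inj_onD[OF h] k xy by (metis add_right_cancel diff_add_cancel)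
  qed
  then show ?case by blast
qed simp

section \<open>Subspaces of finite codimension\<close>

lemma span_Un_subspace:
  assumes "subspace S"
  shows "{x + y | x y. x \<in> S \<and> y \<in> span B} = span (S \<union> B)"
  unfolding span_Un span_eq_iff[THEN iffD2, OF assms] by simp

text \<open>Vectors that are redundant modulo \<open>S\<close> are discarded from \<open>B\<close> one by one. The remaining ones are
  independent and lie outside \<open>S\<close>.\<close>

lemma finite_codim_subspaceI:
  assumes S: "subspace S" and B: "finite B" "span (S \<union> B) = UNIV"
  shows "finite_codim_subspace S"
proof -
  have "\<exists>B'. finite B' \<and> independent B' \<and> B' \<inter> S = {} \<and> span (S \<union> B') = span (S \<union> B)"
    using B(1)
  proof induction
    case empty
    then show ?case by (intro exI[of _ "{}"]) (simp add: independent_empty)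
  next
    case (insert b B)
    then obtain B' where B': "finite B'" "independent B'" "B' \<inter> S = {}"
      "span (S \<union> B') = span (S \<union> B)" by blast
    have eq: "span (insert b (S \<union> B')) = span (insert b (S \<union> B))"
      using B'(4) by (simp add: span_insert)
    show ?case
    proof (cases "b \<in> span (S \<union> B')")
      case True
      then have "span (S \<union> B') = span (S \<union> insert b B)" using eq by (simp add: span_redundant)
      then show ?thesis using B' by blast
    next
      case False
      then have "b \<notin> span B'" "b \<notin> S"
        using span_mono[of B' "S \<union> B'"] span_superset[of "S \<union> B'"] by auto
      then show ?thesis using B' eq
        by (intro exI[of _ "insert b B'"]) (auto simp: independent_insert)
    qed
  qed
  then obtain B' where B': "finite B'" "independent B'" "B' \<inter> S = {}" "span (S \<union> B') = UNIV"
    using B(2) by auto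
  have "span (S \<union> B') \<subseteq> {x + y | x y. x \<in> closure S \<and> y \<in> span B'}"
    unfolding span_Un_subspace[OF S, symmetric] using closure_subset[of S] by blast
  then show ?thesis unfolding finite_codim_subspace_def using S B' by blast
qed

lemma finite_codim_subspaceE:
  assumes "finite_codim_subspace S" "closed S"
  obtains B where "subspace S" "finite B" "span (S \<union> B) = UNIV"
proof -
  have S: "subspace S" using assms(1) by (simp add: finite_codim_subspace_def)
  obtain B where "finite B" "{x + y | x y. x \<in> S \<and> y \<in> span B} = UNIV"
    using assms(1) closure_closed[OF assms(2)] unfolding finite_codim_subspace_def by auto
  then show thesis using that[OF S] span_Un_subspace[OF S, of B] by simp
qed

section \<open>Annihilators of finite sets\<close>

definition annihilator :: "'a::real_normed_vector set \<Rightarrow> ('a \<Rightarrow>\<^sub>L real) set"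
  where "annihilator E = {\<phi>. \<forall>x\<in>E. blinfun_apply \<phi> x = 0}"

lemma subspace_annihilator: "subspace (annihilator E)"
  by (rule subspaceI) (auto simp: annihilator_def blinfun.bilinear_simps)

lemma closed_annihilator: "closed (annihilator E)"
proof -
  have "annihilator E = (\<Inter>x\<in>E. {\<phi>. blinfun_apply \<phi> x = 0})" by (auto simp: annihilator_def)
  then show ?thesis
    by (auto intro!: closed_INT closed_Collect_eq continuous_intros)
qed

lemma annihilator_insert:
  "annihilator (insert x E) = {\<phi> \<in> annihilator E. blinfun_apply \<phi> x = 0}"
  by (auto simp: annihilator_def)

lemma annihilator_finite_complement:
  assumes "finite E"
  shows "\<exists>B. finite B \<and> span (annihilator E \<union> B) = UNIV"
  using assms
proof induction
  case empty
  then show ?case by (intro exI[of _ "{}"]) (auto simp: annihilator_def span_UNIV)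
next
  case (insert x E)
  then obtain B where B: "finite B" "span (annihilator E \<union> B) = UNIV" by blast
  show ?case
  proof (cases "\<forall>\<phi>\<in>annihilator E. blinfun_apply \<phi> x = 0")
    case True
    then have "annihilator (insert x E) = annihilator E" by (auto simp: annihilator_insert)
    then show ?thesis using B by auto
  next
    case False
    then obtain \<psi> where \<psi>: "\<psi> \<in> annihilator E" "blinfun_apply \<psi> x \<noteq> 0" by blast
    let ?U = "span (annihilator (insert x E) \<union> insert \<psi> B)"
    have "\<phi> \<in> ?U" if "\<phi> \<in> annihilator E" for \<phi>
    proof -
      let ?c = "blinfun_apply \<phi> x / blinfun_apply \<psi> x"
      have "\<phi> - ?c *\<^sub>R \<psi> \<in> annihilator E"
        using that \<psi> subspace_annihilator by (intro subspace_diff subspace_scale)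
      then have "\<phi> - ?c *\<^sub>R \<psi> \<in> annihilator (insert x E)"
        using \<psi>(2) by (simp add: annihilator_insert blinfun.bilinear_simps)
      then have "(\<phi> - ?c *\<^sub>R \<psi>) + ?c *\<^sub>R \<psi> \<in> ?U"
        by (intro span_add span_scale) (auto intro: span_base)
      then show ?thesis by simp
    qed
    then have "span (annihilator E \<union> B) \<subseteq> ?U"
      by (intro span_minimal) (auto intro: span_base)
    then show ?thesis using B by (intro exI[of _ "insert \<psi> B"]) auto
  qed
qed

lemma finite_codim_annihilator:
  assumes "finite E" shows "finite_codim_subspace (annihilator E)"
  using annihilator_finite_complement[OF assms] finite_codim_subspaceI[OF subspace_annihilator]
  by blast

text \<open>Each vector added to \<open>B\<close> that is new leaves a nonzero component \<open>y\<close> in the current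
  annihilator. A point where \<open>y\<close> does not vanish is added to \<open>E\<close>, which removes exactly the
  line of \<open>y\<close> from the annihilator.\<close>

lemma annihilator_complement_of_finite_span:
  fixes B :: "('a::real_normed_vector \<Rightarrow>\<^sub>L real) set"
  assumes "finite B"
  shows "\<exists>E. finite E \<and> annihilator E \<inter> span B = {0} \<and> span (annihilator E \<union> B) = UNIV"
  using assms
proof induction
  case empty
  then show ?case by (intro exI[of _ "{}"]) (auto simp: annihilator_def)
next
  case (insert b B)
  then obtain E where E: "finite E" "annihilator E \<inter> span B = {0}"
    "span (annihilator E \<union> B) = UNIV" by blast
  note sub = subspace_annihilator
  obtain y k where b: "b = y + k" "y \<in> annihilator E" "k \<in> span B"
    using E(3) span_Un_subspace[OF sub[of E], of B] by blast
  show ?case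
  proof (cases "y = 0")
    case True
    then have "span (insert b B) = span B" using b by (simp add: span_redundant)
    moreover have "span (annihilator E \<union> insert b B) = UNIV"
      using E(3) span_mono[of "annihilator E \<union> B" "annihilator E \<union> insert b B"] by auto
    ultimately show ?thesis using E by (intro exI[of _ E]) auto
  next
    case False
    then obtain x where x: "blinfun_apply y x \<noteq> 0" 
      using blinfun_eqI[of y 0] by auto
    let ?Y = "annihilator (insert x E)"
    have "z = 0" if z: "z \<in> ?Y" "z \<in> span (insert b B)" for z
    proof -
      obtain t where t: "z - t *\<^sub>R b \<in> span B" using z(2) unfolding span_insert by blast
      have "z - t *\<^sub>R y = (z - t *\<^sub>R b) + t *\<^sub>R k" using b by (simp add: algebra_simps)
      also have "\<dots> \<in> span B" by (rule span_add[OF t span_scale[OF b(3)]])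
      finally have "z - t *\<^sub>R y \<in> span B" .
      moreover have "z - t *\<^sub>R y \<in> annihilator E"
        using z(1) subspace_diff[OF sub _ subspace_scale[OF sub b(2)]]
        by (simp add: annihilator_insert)
      ultimately have "z - t *\<^sub>R y \<in> {0}" using E(2) by blast
      then have zt: "z = t *\<^sub>R y" by simp
      then have "t * blinfun_apply y x = 0"
        using z(1) by (simp add: annihilator_insert blinfun.bilinear_simps)
      then show ?thesis using zt x by simp
    qed
    then have "?Y \<inter> span (insert b B) = {0}"
      using subspace_0[OF sub, of "insert x E"] span_zero[of "insert b B"] by blast
    moreover have "span (?Y \<union> insert b B) = UNIV"
    proof -
      let ?U = "span (?Y \<union> insert b B)"
      have "k \<in> ?U" using b(3) span_mono[of B "?Y \<union> insert b B"] by auto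
      then have "b - k \<in> ?U" by (intro span_diff) (auto intro: span_base)
      then have y: "y \<in> ?U" using b by simp
      have "z \<in> ?U" if z: "z \<in> annihilator E" for z
      proof -
        let ?c = "blinfun_apply z x / blinfun_apply y x"
        have "z - ?c *\<^sub>R y \<in> annihilator E"
          using z b(2) sub by (intro subspace_diff subspace_scale)
        then have "z - ?c *\<^sub>R y \<in> ?Y"
          using x by (simp add: annihilator_insert blinfun.bilinear_simps)
        then have "(z - ?c *\<^sub>R y) + ?c *\<^sub>R y \<in> ?U"
          using y by (intro span_add span_scale) (auto intro: span_base)
        then show ?thesis by simp
      qed
      then have "span (annihilator E \<union> B) \<subseteq> ?U"
        by (intro span_minimal) (auto intro: span_base)
      then show ?thesis using E(3) by auto
    qed
    ultimately show ?thesis using E(1) by (intro exI[of _ "insert x E"]) auto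
  qed
qed

section \<open>Estimates for the adjoint on an annihilator\<close>

definition adjoint_bounded_below ::
  "('v::real_normed_vector \<Rightarrow>\<^sub>L 'x::real_normed_vector) \<Rightarrow> 'x set \<Rightarrow> bool"
  where "adjoint_bounded_below F E \<longleftrightarrow>
    (\<exists>C>0. \<forall>\<phi>\<in>annihilator E. norm \<phi> \<le> C * norm (adjoint_op F \<phi>))"

lemma linear_blinfun_apply: "linear (blinfun_apply f)"
  by (rule bounded_linear.linear[OF blinfun.bounded_linear_right])

lemma annihilator_span:
  assumes "\<phi> \<in> annihilator E" "x \<in> span E"
  shows "blinfun_apply \<phi> x = 0"
  using assms linear_eq_0_on_span[OF linear_blinfun_apply, of E \<phi> x] by (auto simp: annihilator_def)

lemma abs_adjoint_le: "\<bar>blinfun_apply \<phi> (blinfun_apply F v)\<bar> \<le> norm (adjoint_op F \<phi>) * norm v"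
  using norm_blinfun[of "adjoint_op F \<phi>" v] by simp

lemma subspace_ker_adjoint: "subspace {\<phi>. blinfun_apply (adjoint_op F) \<phi> = 0}"
  using linear_subspace_kernel[OF linear_blinfun_apply[of "adjoint_op F"]] .

text \<open>If \<open>B\<close> spans a complement of the range, then every \<open>x\<close> agrees modulo \<open>span B\<close> with some
  \<open>F v\<close>, where \<open>v\<close> is controlled by \<open>x\<close>, and a functional vanishing on \<open>B\<close> cannot see the
  difference.\<close>

lemma closed_range_imp_adjoint_bounded_below:
  fixes F :: "'v::banach \<Rightarrow>\<^sub>L 'x::banach"
  assumes fc: "finite_codim_subspace (range (blinfun_apply F))"
    and cl: "closed (range (blinfun_apply F))"
  obtains E where "finite E" "adjoint_bounded_below F E"
proof -
  obtain B where B: "subspace (range (blinfun_apply F))" "finite B"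
      "span (range (blinfun_apply F) \<union> B) = UNIV"
    using finite_codim_subspaceE[OF fc cl] by blast
  have "UNIV = {blinfun_apply F v + n | v n. v \<in> UNIV \<and> n \<in> span B}"
    using span_Un_subspace[OF B(1), of B] B(3) by (simp add: image_def) blast
  then obtain c where c: "c > 0"
      "\<And>x. \<exists>v. norm v \<le> c * norm x \<and> x - blinfun_apply F v \<in> span B"
    using open_mapping_modulo[OF blinfun.bounded_linear_right subspace_UNIV closed_UNIV
        subspace_span closed_span_finite[OF B(2)] closed_UNIV, of F]
    by (metis UNIV_I)
  have "norm \<phi> \<le> c * norm (adjoint_op F \<phi>)" if \<phi>: "\<phi> \<in> annihilator B" for \<phi>
  proof (rule norm_blinfun_bound)
    fix x
    obtain v where v: "norm v \<le> c * norm x" "x - blinfun_apply F v \<in> span B" using c(2) by blast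
    have "blinfun_apply \<phi> x = blinfun_apply \<phi> (blinfun_apply F v)"
      using annihilator_span[OF \<phi> v(2)] by (simp add: blinfun.diff_right)
    then have "norm (blinfun_apply \<phi> x) \<le> norm (adjoint_op F \<phi>) * norm v"
      using abs_adjoint_le by simp
    also have "\<dots> \<le> norm (adjoint_op F \<phi>) * (c * norm x)" by (intro mult_left_mono v) simp
    finally show "norm (blinfun_apply \<phi> x) \<le> c * norm (adjoint_op F \<phi>) * norm x"
      by (simp add: mult_ac)
  qed (use c in simp)
  then show thesis using that[OF B(2)] c(1) unfolding adjoint_bounded_below_def by blast
qed

text \<open>The infimum \<open>p x\<close> of \<open>norm v + K * norm (x - F v - n)\<close> measures how well \<open>x\<close> is
  approximated by the sum of the range and \<open>span E\<close>. A functional \<open>\<phi> \<le> p\<close> with \<open>\<phi> x = p x\<close>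
  vanishes on \<open>E\<close> and its adjoint image has norm at most 1, so the estimate gives
  \<open>p x \<le> C * norm x\<close> for every \<open>K\<close>. A large \<open>K\<close> makes the error of approximation small.\<close>

lemma adjoint_bounded_below_imp_almost_open:
  fixes F :: "'v::real_normed_vector \<Rightarrow>\<^sub>L 'x::real_normed_vector"
  assumes C: "C > 0" "\<And>\<phi>. \<phi> \<in> annihilator E \<Longrightarrow> norm \<phi> \<le> C * norm (adjoint_op F \<phi>)"
    and e: "e > 0"
  shows "\<exists>v. \<exists>n\<in>span E. norm v \<le> (C + 1) * norm x \<and> norm (x - blinfun_apply F v - n) \<le> e"
proof (cases "x = 0")
  case True
  then show ?thesis using e span_zero by (intro exI[of _ 0] bexI[of _ 0]) auto
next
  case False
  define K where "K = (C + 1) * norm x / e"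
  have K: "K > 0" using False C e by (simp add: K_def)
  define I :: "('v \<times> 'x) set" where "I = UNIV \<times> span E"
  define R where "R = (\<lambda>(v, n) x. norm v + K * norm (x - blinfun_apply F v - n))"
  have I0: "(0, 0) \<in> I" by (simp add: I_def span_zero)
  have R: "R (v, n) x = norm v + K * norm (x - blinfun_apply F v - n)" for v n x
    by (simp add: R_def)
  have R0: "R i x \<ge> 0" for i x using K by (cases i) (simp add: R)
  have bdd: "bdd_below ((\<lambda>i. R i x) ` I)" for x using R0 by (intro bdd_belowI2[of _ 0])
  define p where "p x = (INF i\<in>I. R i x)" for x
  have p: "sublinear p" unfolding p_def
  proof (rule sublinear_INF[OF _ bdd])
    fix i j x y assume ij: "i \<in> I" "j \<in> I"
    obtain v n w m where vn: "i = (v, n)" "j = (w, m)" by (metis surj_pair)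
    have "norm (x + y - blinfun_apply F (v + w) - (n + m))
        \<le> norm (x - blinfun_apply F v - n) + norm (y - blinfun_apply F w - m)"
      using norm_triangle_ineq[of "x - blinfun_apply F v - n" "y - blinfun_apply F w - m"]
      by (simp add: blinfun.add_right algebra_simps)
    then have "K * norm (x + y - blinfun_apply F (v + w) - (n + m))
        \<le> K * norm (x - blinfun_apply F v - n) + K * norm (y - blinfun_apply F w - m)"
      using K by (simp flip: distrib_left)
    then have "R (v + w, n + m) (x + y) \<le> R i x + R j y"
      using norm_triangle_ineq[of v w] unfolding vn R by linarith
    moreover have "(v + w, n + m) \<in> I" using ij vn by (simp add: I_def span_add)
    ultimately show "\<exists>k\<in>I. R k (x + y) \<le> R i x + R j y" by blast
  next
    fix i c x assume i: "i \<in> I" and c: "(c::real) > 0"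
    obtain v n where vn: "i = (v, n)" by (metis surj_pair)
    have "c *\<^sub>R x - blinfun_apply F (c *\<^sub>R v) - c *\<^sub>R n = c *\<^sub>R (x - blinfun_apply F v - n)"
      by (simp add: blinfun.scaleR_right algebra_simps)
    then have "norm (c *\<^sub>R x - blinfun_apply F (c *\<^sub>R v) - c *\<^sub>R n)
        = c * norm (x - blinfun_apply F v - n)"
      using c by simp
    then have "R (c *\<^sub>R v, c *\<^sub>R n) (c *\<^sub>R x) \<le> c * R i x"
      using c unfolding vn R by (simp add: distrib_left)
    moreover have "(c *\<^sub>R v, c *\<^sub>R n) \<in> I" using i vn by (simp add: I_def span_scale)
    ultimately show "\<exists>k\<in>I. R k (c *\<^sub>R x) \<le> c * R i x" by blast
  qed (use I0 in blast)
  have p_le: "p y \<le> norm v + K * norm (y - blinfun_apply F v - n)" if "n \<in> span E" for y v n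
    using cINF_lower[OF bdd, of "(v, n)" y] that unfolding p_def by (simp add: I_def R)
  obtain f where f: "linear f" "\<And>y. f y \<le> p y" "f x = p x"
    using Hahn_Banach_sublinear[OF p] by blast
  have f_le: "f y \<le> norm v + K * norm (y - blinfun_apply F v - n)" if "n \<in> span E" for y v n
    using f(2) p_le[OF that] order_trans by blast
  obtain \<phi> :: "'x \<Rightarrow>\<^sub>L real" where \<phi>: "blinfun_apply \<phi> = f"
    using blinfun_from_linear_le[OF f(1), of K] f_le[OF span_zero, of _ 0] by auto
  have "blinfun_apply \<phi> n = 0" if "n \<in> E" for n
    using f_le[of n n 0] f_le[of "- n" "- n" 0] that linear_neg[OF f(1), of n]
    by (simp add: \<phi> span_base span_neg)
  then have ann: "\<phi> \<in> annihilator E" by (simp add: annihilator_def)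
  have "norm (adjoint_op F \<phi>) \<le> 1"
  proof (rule norm_blinfun_bound)
    fix v
    show "norm (blinfun_apply (adjoint_op F \<phi>) v) \<le> 1 * norm v"
      using f_le[OF span_zero, of "blinfun_apply F v" v] f_le[OF span_zero, of "- blinfun_apply F v" "- v"]
        linear_neg[OF f(1)]
      by (simp add: \<phi> blinfun.minus_right)
  qed simp
  then have "norm \<phi> \<le> C" 
    using C(2)[OF ann] mult_left_mono[OF _ less_imp_le[OF C(1)], of "norm (adjoint_op F \<phi>)" 1]
    by simp
  then have "p x \<le> C * norm x"
    using norm_blinfun[of \<phi> x] f(3) \<phi> mult_right_mono[of "norm \<phi>" C "norm x"] by auto
  moreover have "norm x > 0" using False by simp
  ultimately have "p x < (C + 1) * norm x" unfolding distrib_right by linarith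
  then obtain i where "i \<in> I" "R i x < (C + 1) * norm x"
    unfolding p_def using cINF_less_iff[OF _ bdd] I0 by (metis empty_iff)
  then obtain v n where vn: "n \<in> span E"
    "norm v + K * norm (x - blinfun_apply F v - n) < (C + 1) * norm x"
    by (cases i) (auto simp: I_def R)
  have v: "norm v \<le> (C + 1) * norm x"
    using vn(2) mult_nonneg_nonneg[OF less_imp_le[OF K] norm_ge_zero[of "x - blinfun_apply F v - n"]]
    by linarith
  have "K * e = (C + 1) * norm x" using e by (simp add: K_def)
  then have "K * norm (x - blinfun_apply F v - n) \<le> K * e"
    using vn(2) norm_ge_zero[of v] by linarith
  then have "norm (x - blinfun_apply F v - n) \<le> e" using K by simp
  then show ?thesis using v vn(1) by blast
qed

lemma adjoint_bounded_below_imp_range_span: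
  fixes F :: "'v::banach \<Rightarrow>\<^sub>L 'x::banach"
  assumes E: "finite E" "adjoint_bounded_below F E"
  obtains v where "x - blinfun_apply F v \<in> span E"
proof -
  obtain C where C: "C > 0" "\<And>\<phi>. \<phi> \<in> annihilator E \<Longrightarrow> norm \<phi> \<le> C * norm (adjoint_op F \<phi>)"
    using E(2) unfolding adjoint_bounded_below_def by blast
  have "\<exists>v\<in>UNIV. norm v \<le> 2 * (C + 1) * norm x \<and> x - blinfun_apply F v \<in> span E"
    by (rule almost_open_imp_open[OF blinfun.bounded_linear_right subspace_UNIV closed_UNIV
          subspace_span closed_span_finite[OF E(1)] subspace_UNIV])
      (use adjoint_bounded_below_imp_almost_open[OF C] C(1) in auto)
  then show thesis using that by blast
qed

text \<open>The kernel is finite-dimensional because it meets \<open>Y\<close>, a subspace of finite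
  codimension, trivially. The image of \<open>Y\<close> is closed
  by the estimate, and the whole range exceeds it by finitely many dimensions.\<close>

lemma bounded_below_imp_ker_and_range_adjoint:
  fixes F :: "'v::banach \<Rightarrow>\<^sub>L 'x::banach"
  assumes Y: "finite_codim_subspace Y" "closed Y" and C: "C > 0"
    and bd: "\<And>\<phi>. \<phi> \<in> Y \<Longrightarrow> norm \<phi> \<le> C * norm (adjoint_op F \<phi>)"
  shows "\<exists>B. finite B \<and> {\<phi>. blinfun_apply (adjoint_op F) \<phi> = 0} = span B"
    and "closed (range (blinfun_apply (adjoint_op F)))"
proof -
  obtain B where B: "subspace Y" "finite B" "span (Y \<union> B) = UNIV"
    using finite_codim_subspaceE[OF Y] by blast
  have spY: "span Y = Y" using B(1) by (simp add: span_eq_iff)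
  let ?K = "{\<phi>. blinfun_apply (adjoint_op F) \<phi> = 0}"
  let ?T = "blinfun_apply (adjoint_op F)"
  have lin: "linear ?T" by (rule linear_blinfun_apply)
  have "\<phi> = 0" if "\<phi> \<in> ?K" "\<phi> \<in> Y" for \<phi> using bd[OF that(2)] that(1) by simp
  then have "?K \<inter> span Y = span {}"
    unfolding spY using subspace_0[OF B(1)] subspace_0[OF subspace_ker_adjoint[of F]] by auto
  then have "\<exists>A. finite A \<and> ?K \<inter> span (Y \<union> B) = span A"
    by (intro subspace_Int_span_Un_finite subspace_ker_adjoint B(2) exI[of _ "{}"]) auto
  then show "\<exists>B. finite B \<and> ?K = span B" using B(3) by simp
  have "complete (?T ` Y)"
  proof (rule complete_isometric_image)
    show "\<forall>x\<in>Y. (1 / C) * norm x \<le> norm (?T x)" using bd C by (simp add: field_simps)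
    show "complete Y" using Y(2) by (simp add: complete_eq_closed)
  qed (use C B(1) blinfun.bounded_linear_right in auto)
  then have "closed (span (?T ` Y))"
    using complete_imp_closed linear_subspace_image[OF lin B(1)] by (simp add: span_eq_iff[THEN iffD2])
  then have "closed (span (?T ` Y \<union> ?T ` B))" using B(2) by (intro closed_span_Un_finite) auto
  then show "closed (range ?T)"
    using B(3) linear_span_image[OF lin, of "Y \<union> B"] by (simp add: image_Un)
qed

text \<open>The set \<open>E\<close> is chosen so that its annihilator is a complement of the kernel. The adjoint then
  restricts to a bijection from the annihilator onto the closed range, to which the open mapping
  theorem applies.\<close>

lemma adjoint_bounded_below_on_complement:
  fixes F :: "'v::banach \<Rightarrow>\<^sub>L 'x::banach"
  assumes B: "finite B" "{\<phi>. blinfun_apply (adjoint_op F) \<phi> = 0} = span B"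
    and cl: "closed (range (blinfun_apply (adjoint_op F)))"
  obtains E where "finite E" "annihilator E \<inter> span B = {0}" "span (annihilator E \<union> B) = UNIV"
    "adjoint_bounded_below F E"
proof -
  obtain E where E: "finite E" "annihilator E \<inter> span B = {0}" "span (annihilator E \<union> B) = UNIV"
    using annihilator_complement_of_finite_span[OF B(1)] by blast
  let ?T = "blinfun_apply (adjoint_op F)"
  have lin: "linear ?T" by (rule linear_blinfun_apply)
  have "?T ` annihilator E = range ?T"
  proof
    show "range ?T \<subseteq> ?T ` annihilator E"
    proof clarify
      fix \<phi>
      obtain \<psi> \<kappa> where "\<phi> = \<psi> + \<kappa>" "\<psi> \<in> annihilator E" "\<kappa> \<in> span B"
        using E(3) span_Un_subspace[OF subspace_annihilator, of E B] by blast
      moreover from this have "?T \<kappa> = 0" using B(2) by blast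
      ultimately have "?T \<phi> = ?T \<psi>" using linear_add[OF lin, of \<psi> \<kappa>] by simp
      then show "?T \<phi> \<in> ?T ` annihilator E" using \<open>\<psi> \<in> annihilator E\<close> by blast
    qed
  qed auto
  then obtain c where c: "c > 0"
      "\<And>\<phi>. \<exists>\<psi>\<in>annihilator E. norm \<psi> \<le> c * norm (?T \<phi>) \<and> ?T \<psi> = ?T \<phi>"
    using open_mapping_range[OF blinfun.bounded_linear_right subspace_annihilator
        closed_annihilator, of "adjoint_op F" E] cl
    by (metis rangeI)
  have "norm \<phi> \<le> c * norm (?T \<phi>)" if \<phi>: "\<phi> \<in> annihilator E" for \<phi>
  proof -
    obtain \<psi> where \<psi>: "\<psi> \<in> annihilator E" "norm \<psi> \<le> c * norm (?T \<phi>)" "?T \<psi> = ?T \<phi>"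
      using c(2) by blast
    have "\<phi> - \<psi> \<in> annihilator E" by (rule subspace_diff[OF subspace_annihilator \<phi> \<psi>(1)])
    moreover have "?T (\<phi> - \<psi>) = 0" using \<psi>(3) linear_diff[OF lin, of \<phi> \<psi>] by simp
    ultimately have "\<phi> - \<psi> \<in> {0}" using E(2) B(2) by blast
    then show ?thesis using \<psi>(2) by simp
  qed
  then show thesis using that[OF E] c(1) unfolding adjoint_bounded_below_def by blast
qed

text \<open>A vector of \<open>span E\<close> in the closure of the range is killed by the kernel of the adjoint and
  by the annihilator of \<open>E\<close>, hence by all functionals, so it is 0. This makes the range
  closed.\<close>

lemma ker_and_range_adjoint_imp_closed_range:
  fixes F :: "'v::banach \<Rightarrow>\<^sub>L 'x::banach"
  assumes B: "finite B" "{\<phi>. blinfun_apply (adjoint_op F) \<phi> = 0} = span B"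
    and cl: "closed (range (blinfun_apply (adjoint_op F)))"
  shows "finite_codim_subspace (range (blinfun_apply F))" "closed (range (blinfun_apply F))"
proof -
  obtain E where E: "finite E" "annihilator E \<inter> span B = {0}" "span (annihilator E \<union> B) = UNIV"
    "adjoint_bounded_below F E"
    using adjoint_bounded_below_on_complement[OF B cl] by blast
  let ?R = "range (blinfun_apply F)"
  have sub: "subspace ?R"
    using linear_subspace_image[OF linear_blinfun_apply subspace_UNIV] .
  have "x \<in> span (?R \<union> E)" for x
  proof -
    obtain v where "x - blinfun_apply F v \<in> span E"
      using adjoint_bounded_below_imp_range_span[OF E(1,4)] by blast
    then have "x - blinfun_apply F v \<in> span (?R \<union> E)"
      using span_mono[of E "?R \<union> E"] by blast
    moreover have "blinfun_apply F v \<in> span (?R \<union> E)" by (intro span_base) simp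
    ultimately show ?thesis using span_add by fastforce
  qed
  then show "finite_codim_subspace ?R" using finite_codim_subspaceI[OF sub E(1)] by blast
  have "x \<in> ?R" if x: "x \<in> closure ?R" for x
  proof -
    obtain v where v: "x - blinfun_apply F v \<in> span E"
      using adjoint_bounded_below_imp_range_span[OF E(1,4)] by blast
    have kill: "blinfun_apply \<kappa> y = 0" if "\<kappa> \<in> span B" "y \<in> closure ?R" for \<kappa> y
    proof -
      have "adjoint_op F \<kappa> = 0" using that(1) B(2) by blast
      then have "blinfun_apply \<kappa> (blinfun_apply F w) = 0" for w
        by (metis adjoint_op_apply blinfun_apply_blinfun_compose zero_blinfun.rep_eq)
      then have "?R \<subseteq> {y. blinfun_apply \<kappa> y = 0}" by auto
      moreover have "closed {y. blinfun_apply \<kappa> y = 0}"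
        by (intro closed_Collect_eq continuous_intros)
      ultimately show ?thesis using closure_minimal that(2) by blast
    qed
    have "x - blinfun_apply F v = 0"
    proof (rule functionals_separate_points)
      fix \<phi> :: "'x \<Rightarrow>\<^sub>L real"
      obtain \<psi> \<kappa> where "\<phi> = \<psi> + \<kappa>" "\<psi> \<in> annihilator E" "\<kappa> \<in> span B"
        using E(3) span_Un_subspace[OF subspace_annihilator, of E B] by blast
      moreover have "blinfun_apply F v \<in> closure ?R" using closure_subset[of ?R] by blast
      ultimately show "blinfun_apply \<phi> (x - blinfun_apply F v) = 0"
        using kill x annihilator_span[OF _ v] by (simp add: blinfun.add_left blinfun.diff_right)
    qed
    then show ?thesis by simp
  qed
  then have "closure ?R = ?R" using closure_subset by blast
  then show "closed ?R" using closure_eq by blast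
qed

section \<open>The image of the unit ball\<close>

text \<open>Undoing the translation by \<open>x0\<close>, the closure of the convex set \<open>M\<close> contains a ball of the
  closed subspace \<open>S\<close>. So \<open>F\<close> is almost open onto \<open>S\<close>, hence surjective onto \<open>S\<close>, and the range is
  \<open>S\<close>.\<close>

lemma finite_codim_set_imp_closed_range:
  fixes F :: "'v::banach \<Rightarrow>\<^sub>L 'x::banach"
  assumes fc: "finite_codim_set {blinfun_apply F v | v. norm v \<le> 1}"
  shows "finite_codim_subspace (range (blinfun_apply F))" "closed (range (blinfun_apply F))"
proof -
  define M where "M = {blinfun_apply F v | v. norm v \<le> 1}"
  let ?R = "range (blinfun_apply F)"
  have "M = blinfun_apply F ` cball 0 1" by (auto simp: M_def)
  then have cvx: "convex M"
    by (simp add: convex_linear_image[OF linear_blinfun_apply convex_cball])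
  obtain x0 where x0: "x0 \<in> closure (convex hull M)"
    and S: "finite_codim_subspace (closure (span ((\<lambda>x. x - x0) ` M)))"
    and int: "(top_of_set (closure (span ((\<lambda>x. x - x0) ` M))))
        interior_of (closure (convex hull ((\<lambda>x. x - x0) ` M))) \<noteq> {}"
    using fc unfolding finite_codim_set_def Let_def M_def by blast
  define S where "S = closure (span ((\<lambda>x. x - x0) ` M))"
  have subS: "subspace S" using S by (simp add: S_def finite_codim_subspace_def)
  have D0S: "x - x0 \<in> S" if "x \<in> M" for x
    using that closure_subset[of "span ((\<lambda>x. x - x0) ` M)"] span_base[of "x - x0" "(\<lambda>x. x - x0) ` M"]
    by (auto simp: S_def)
  have "0 \<in> M" unfolding M_def by (auto intro!: exI[of _ 0])
  then have x0S: "x0 \<in> S" using D0S[of 0] subspace_neg[OF subS, of "0 - x0"] by simp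
  have MS: "x \<in> S" if "x \<in> M" for x using subspace_add[OF subS D0S[OF that] x0S] by simp
  have RS: "blinfun_apply F v \<in> S" for v
  proof (cases "v = 0")
    case True
    then show ?thesis using subspace_0[OF subS] by simp
  next
    case False
    have "blinfun_apply F (v /\<^sub>R norm v) \<in> M"
      unfolding M_def using False by (intro CollectI exI[of _ "v /\<^sub>R norm v"]) simp
    then have "norm v *\<^sub>R blinfun_apply F (v /\<^sub>R norm v) \<in> S"
      by (intro subspace_scale[OF subS] MS)
    then show ?thesis using False by (simp add: blinfun.scaleR_right)
  qed
  have hull: "closure (convex hull ((\<lambda>x. x - x0) ` M)) = (\<lambda>x. x - x0) ` closure M"
    using cvx by (simp add: hull_same closure_translation_subtract)
  obtain p where p: "p \<in> (top_of_set S) interior_of ((\<lambda>x. x - x0) ` closure M)"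
    using int unfolding hull S_def by blast
  have "openin (top_of_set S) ((top_of_set S) interior_of ((\<lambda>x. x - x0) ` closure M))" by simp
  then obtain r where "r > 0" and pS: "p \<in> S" and ball: "\<forall>y\<in>S. dist y p < r \<longrightarrow>
      y \<in> (top_of_set S) interior_of ((\<lambda>x. x - x0) ` closure M)"
    using p unfolding openin_euclidean_subtopology_iff by blast
  have near: "y \<in> closure M" if "y \<in> S" "dist y (p + x0) < r" for y
  proof -
    have "y - x0 \<in> S" "dist (y - x0) p < r"
      using that subspace_diff[OF subS _ x0S] by (auto simp: dist_norm algebra_simps)
    then have "y - x0 \<in> (top_of_set S) interior_of ((\<lambda>x. x - x0) ` closure M)" using ball by blast
    then have "y - x0 \<in> (\<lambda>x. x - x0) ` closure M"
      using interior_of_subset[of "top_of_set S" "(\<lambda>x. x - x0) ` closure M"] by blast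
    then show ?thesis by auto
  qed
  have Meq: "M = {blinfun_apply F v + n | v n. v \<in> UNIV \<and> n \<in> {0} \<and> norm v \<le> 1}"
    by (auto simp: M_def)
  obtain c where c: "c > 0" "\<And>x e. x \<in> S \<Longrightarrow> e > 0 \<Longrightarrow>
      \<exists>v\<in>UNIV. \<exists>n\<in>{0}. norm v \<le> c * norm x \<and> norm (x - blinfun_apply F v - n) \<le> e"
    using dense_in_ball_imp_almost_open[OF linear_blinfun_apply subspace_UNIV subspace_single_0
        subS Meq subspace_add[OF subS pS x0S] \<open>r > 0\<close> near] by blast
  have "\<exists>v\<in>UNIV. norm v \<le> 2 * c * norm x \<and> x - blinfun_apply F v \<in> {0}" if "x \<in> S" for x
    by (rule almost_open_imp_open[OF blinfun.bounded_linear_right subspace_UNIV closed_UNIV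
          subspace_single_0 closed_singleton subS _ _ less_imp_le[OF c(1)] c(2) that])
      (use RS subspace_0[OF subS] in auto)
  then have "S \<subseteq> ?R" by fastforce
  then have "S = ?R" using RS by auto
  moreover have "closed S" by (simp add: S_def)
  ultimately show "finite_codim_subspace ?R" "closed ?R" using S by (simp_all add: S_def)
qed

text \<open>With \<open>x0 = 0\<close> the subspace to consider is the range itself, and by the open mapping theorem
  \<open>M\<close> contains a ball of it.\<close>

lemma closed_range_imp_finite_codim_set:
  fixes F :: "'v::banach \<Rightarrow>\<^sub>L 'x::banach"
  assumes fc: "finite_codim_subspace (range (blinfun_apply F))"
    and cl: "closed (range (blinfun_apply F))"
  shows "finite_codim_set {blinfun_apply F v | v. norm v \<le> 1}"
proof -
  define M where "M = {blinfun_apply F v | v. norm v \<le> 1}"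
  let ?R = "range (blinfun_apply F)"
  have subR: "subspace ?R" using fc by (simp add: finite_codim_subspace_def)
  obtain c where c: "c > 0" "\<And>x. x \<in> ?R \<Longrightarrow> \<exists>v\<in>UNIV. norm v \<le> c * norm x \<and> blinfun_apply F v = x"
    using open_mapping_range[OF blinfun.bounded_linear_right subspace_UNIV closed_UNIV cl] by blast
  have ball: "?R \<inter> ball 0 (1 / c) \<subseteq> M"
  proof
    fix x assume x: "x \<in> ?R \<inter> ball 0 (1 / c)"
    then obtain v where v: "norm v \<le> c * norm x" "blinfun_apply F v = x" using c(2)[of x] by auto
    have "c * norm x < 1" using x c(1) by (simp add: field_simps)
    then have "norm v \<le> 1" using v(1) by simp
    then show "x \<in> M" using v(2) unfolding M_def by blast
  qed
  have M0: "0 \<in> M" unfolding M_def by (auto intro!: exI[of _ 0])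
  have "span M = ?R"
  proof
    show "span M \<subseteq> ?R" by (rule span_minimal[OF _ subR]) (auto simp: M_def)
    show "?R \<subseteq> span M"
    proof clarify
      fix v :: 'v
      have pos: "norm v + 1 > 0" by (simp add: add_nonneg_pos)
      then have "norm (v /\<^sub>R (norm v + 1)) = norm v / (norm v + 1)"
        by (simp add: divide_inverse mult.commute)
      also have "\<dots> \<le> 1" using pos by (simp add: divide_le_eq)
      finally have "blinfun_apply F (v /\<^sub>R (norm v + 1)) \<in> M" unfolding M_def by blast
      then have "(norm v + 1) *\<^sub>R blinfun_apply F (v /\<^sub>R (norm v + 1)) \<in> span M"
        by (intro span_scale span_base)
      then show "blinfun_apply F v \<in> span M" using pos by (simp add: blinfun.scaleR_right)
    qed
  qed
  then have S: "closure (span M) = ?R" using cl by simp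
  have "?R \<inter> ball 0 (1 / c) \<subseteq> (top_of_set ?R) interior_of (closure (convex hull M))"
  proof (rule interior_of_maximal)
    show "?R \<inter> ball 0 (1 / c) \<subseteq> closure (convex hull M)"
      using ball hull_subset[of M convex] closure_subset[of "convex hull M"] by blast
    show "openin (top_of_set ?R) (?R \<inter> ball 0 (1 / c))" by (simp add: openin_open_Int)
  qed
  moreover have "0 \<in> ?R \<inter> ball 0 (1 / c)" using c(1) subspace_0[OF subR] by simp
  ultimately have int: "(top_of_set ?R) interior_of (closure (convex hull M)) \<noteq> {}" by blast
  have "0 \<in> closure (convex hull M)"
    using M0 hull_subset[of M convex] closure_subset[of "convex hull M"] by blast
  then have "finite_codim_set M"
    unfolding finite_codim_set_def Let_def
    by (intro bexI[of _ 0]) (use S fc int in auto)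
  then show ?thesis by (simp add: M_def)
qed

section \<open>Compact perturbations of the adjoint estimate\<close>

text \<open>If no annihilator works, then unit functionals \<open>\<phi>\<close> with small adjoint image exist in the
  annihilator of any finite set. Choosing them one after the other, each in the annihilator of the
  points \<open>x\<close> at which the earlier ones are large, keeps them 1/2 apart. The estimate then
  separates the vectors \<open>G \<phi>\<close> uniformly, against compactness.\<close>

lemma compact_perturbation_imp_adjoint_bounded_below:
  fixes F :: "'v::real_normed_vector \<Rightarrow>\<^sub>L 'x::real_normed_vector"
  assumes W: "carrier_banach_space W add zero smul nrm"
    and G: "carrier_banach_space.compact_operator W add smul nrm G" and C: "C > 0"
    and bd: "\<And>\<phi>. norm \<phi> \<le> C * (norm (adjoint_op F \<phi>) + nrm (G \<phi>))"
  shows "\<exists>E. finite E \<and> adjoint_bounded_below F E"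
proof -
  interpret W: carrier_banach_space W add zero smul nrm by fact
  let ?d = "carrier_dist W add smul nrm"
  interpret M: Metric_space W ?d by (rule W.metric)
  have Gr: "range G \<subseteq> W" and Gadd: "\<And>x y. G (x + y) = add (G x) (G y)"
    and Gsc: "\<And>a x. G (a *\<^sub>R x) = smul a (G x)"
    and cpt: "compactin M.mtopology (M.mtopology closure_of (G ` cball 0 1))"
    using G unfolding W.compact_operator_def Let_def by auto
  have dG: "?d (G \<phi>) (G \<psi>) = nrm (G (\<phi> - \<psi>))" for \<phi> \<psi>
    using Gr Gadd[of \<phi> "- \<psi>"] Gsc[of "-1" \<psi>] by (auto simp: carrier_dist_def)
  show ?thesis
  proof (rule ccontr)
    assume "\<not> ?thesis"
    then have none: "\<not> adjoint_bounded_below F E" if "finite E" for E using that by blast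
    \<comment> \<open>With the factor 8 the adjoint images of two such functionals account for at most half of
      their distance 1/2, and \<open>G\<close> has to account for the rest.\<close>
    have ex: "\<exists>\<phi> x. \<phi> \<in> annihilator E \<and> norm \<phi> = 1 \<and> 8 * C * norm (adjoint_op F \<phi>) < 1 \<and>
        norm x / 2 < \<bar>blinfun_apply \<phi> x\<bar>" if "finite E" for E
    proof -
      obtain \<psi> where \<psi>: "\<psi> \<in> annihilator E" "8 * C * norm (adjoint_op F \<psi>) < norm \<psi>"
        using none[OF \<open>finite E\<close>] C unfolding adjoint_bounded_below_def
        by (meson linorder_not_less mult_pos_pos zero_less_numeral)
      have "0 \<le> 8 * C * norm (adjoint_op F \<psi>)" using C by simp
      then have pos: "norm \<psi> > 0" using \<psi>(2) by linarith
      define \<phi> where "\<phi> = \<psi> /\<^sub>R norm \<psi>"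
      have \<phi>: "\<phi> \<in> annihilator E" "norm \<phi> = 1"
        using \<psi>(1) pos subspace_scale[OF subspace_annihilator] by (auto simp: \<phi>_def)
      have "norm (adjoint_op F \<phi>) = norm (adjoint_op F \<psi>) / norm \<psi>"
        by (simp only: \<phi>_def blinfun.scaleR_right norm_scaleR) (simp add: divide_inverse mult.commute)
      then have "8 * C * norm (adjoint_op F \<phi>) = 8 * C * norm (adjoint_op F \<psi>) / norm \<psi>"
        by simp
      also have "\<dots> < 1" unfolding divide_less_eq_1_pos[OF pos] by (rule \<psi>(2))
      finally have "8 * C * norm (adjoint_op F \<phi>) < 1" .
      moreover have "\<exists>x. norm x / 2 < \<bar>blinfun_apply \<phi> x\<bar>"
      proof (rule ccontr)
        assume "\<not> ?thesis"
        then have "norm \<phi> \<le> 1 / 2" by (intro norm_blinfun_bound) (auto simp: not_less)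
        then show False using \<phi>(2) by simp
      qed
      ultimately show ?thesis using \<phi> by blast
    qed
    then obtain \<Phi> X where \<Phi>: "\<And>E. finite E \<Longrightarrow> \<Phi> E \<in> annihilator E \<and> norm (\<Phi> E) = 1 \<and>
        8 * C * norm (adjoint_op F (\<Phi> E)) < 1 \<and> norm (X E) / 2 < \<bar>blinfun_apply (\<Phi> E) (X E)\<bar>"
      by metis
    define E where "E = rec_nat {} (\<lambda>_ E. insert (X E) E)"
    have E: "E 0 = {}" "E (Suc n) = insert (X (E n)) (E n)" for n by (simp_all add: E_def)
    have fin: "finite (E n)" for n by (induction n) (simp_all add: E)
    have mem: "X (E n) \<in> E m" if "n < m" for n m
      using that by (induction m) (auto simp: E less_Suc_eq)
    have sep: "1 / (4 * C) < ?d (G (\<Phi> (E n))) (G (\<Phi> (E m)))" if "n < m" for n m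
    proof -
      let ?a = "\<Phi> (E n)" and ?b = "\<Phi> (E m)" and ?x = "X (E n)"
      have "blinfun_apply ?b ?x = 0" using \<Phi>[OF fin[of m]] mem[OF that] by (auto simp: annihilator_def)
      then have "norm ?x / 2 < norm (blinfun_apply (?a - ?b) ?x)"
        using \<Phi>[OF fin[of n]] by (simp add: blinfun.diff_left)
      also have "\<dots> \<le> norm (?a - ?b) * norm ?x" by (rule norm_blinfun)
      finally have "(1 / 2) * norm ?x < norm (?a - ?b) * norm ?x" by simp
      then have "1 / 2 < norm (?a - ?b)" by (rule mult_right_less_imp_less) simp
      also have "\<dots> \<le> C * (norm (adjoint_op F (?a - ?b)) + nrm (G (?a - ?b)))" by (rule bd)
      also have "\<dots> \<le> C * (norm (adjoint_op F ?a) + norm (adjoint_op F ?b) + nrm (G (?a - ?b)))"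
        using C norm_triangle_ineq4[of "adjoint_op F ?a" "adjoint_op F ?b"]
          blinfun.diff_right[of "adjoint_op F" ?a ?b]
        by (intro mult_left_mono) simp_all
      also have "\<dots> < 1 / 4 + C * nrm (G (?a - ?b))"
        using \<Phi>[OF fin[of n]] \<Phi>[OF fin[of m]] unfolding distrib_left by linarith
      finally have "1 / 4 < C * nrm (G (?a - ?b))" by simp
      then show ?thesis using C unfolding dG by (simp add: field_simps)
    qed
    define \<sigma> where "\<sigma> n = G (\<Phi> (E n))" for n
    have "range \<sigma> \<subseteq> G ` cball 0 1" using \<Phi> fin by (auto simp: \<sigma>_def)
    also have "\<dots> \<subseteq> M.mtopology closure_of (G ` cball 0 1)"
      using Gr by (intro closure_of_subset) auto
    finally obtain l \<rho> where \<rho>: "strict_mono \<rho>" and l: "limitin M.mtopology (\<sigma> \<circ> \<rho>) l sequentially"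
      using cpt unfolding M.compactin_sequentially by blast
    have "M.MCauchy (\<sigma> \<circ> \<rho>)"
      by (rule M.convergent_imp_MCauchy[OF _ l]) (use Gr in \<open>auto simp: \<sigma>_def\<close>)
    moreover have "1 / (4 * C) > 0" using C by simp
    ultimately obtain N where "\<forall>n n'. N \<le> n \<longrightarrow> N \<le> n' \<longrightarrow> ?d (\<sigma> (\<rho> n)) (\<sigma> (\<rho> n')) < 1 / (4 * C)"
      unfolding M.MCauchy_def comp_def by blast
    then have "?d (\<sigma> (\<rho> N)) (\<sigma> (\<rho> (Suc N))) < 1 / (4 * C)" by simp
    moreover have "\<rho> N < \<rho> (Suc N)" using \<rho> by (simp add: strict_mono_def)
    ultimately show False using sep unfolding \<sigma>_def by (meson less_asym)
  qed
qed

section \<open>Transporting a finite-dimensional space to the universe of carriers\<close>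

text \<open>An injection of a complete subspace \<open>K\<close> into any type carries its structure over to the
  image. For a finite-dimensional \<open>K\<close> such an injection into the reals exists by
  \<open>inj_on_span_finite_real\<close>, and bounded subsets of \<open>K\<close> are relatively compact, so boundedness makes
  \<open>G\<close> a compact operator.\<close>

lemma finite_rank_imp_carrier_compact:
  fixes G :: "'a::real_normed_vector \<Rightarrow> 'b::banach"
  assumes B: "finite B" and G: "linear G" "\<And>x. G x \<in> span B" "\<And>x. norm (G x) \<le> c * norm x"
  obtains W :: "'w universe set" and add zero smul nrm G'
  where "carrier_banach_space W add zero smul nrm"
    "carrier_banach_space.compact_operator W add smul nrm G'" "\<And>x. nrm (G' x) = norm (G x)"
proof -
  define K where "K = span B"
  have K: "subspace K" by (simp add: K_def)
  obtain h :: "'b \<Rightarrow> real" where "inj_on h K"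
    using inj_on_span_finite_real[OF B] unfolding K_def by blast
  define J :: "'b \<Rightarrow> 'w universe" where "J = Inl \<circ> h"
  have inj: "inj_on J K" using \<open>inj_on h K\<close> by (auto simp: J_def inj_on_def)
  define i where "i = inv_into K J"
  have iJ: "x \<in> K \<Longrightarrow> i (J x) = x" for x by (simp add: i_def inv_into_f_f[OF inj])
  define W where "W = J ` K"
  define add where "add = (\<lambda>a b. J (i a + i b))"
  define smul where "smul = (\<lambda>r a. J (r *\<^sub>R i a))"
  define nrm where "nrm = (\<lambda>a. norm (i a))"
  note ops = add_def smul_def nrm_def
  have memK: "0 \<in> K" "x \<in> K \<Longrightarrow> y \<in> K \<Longrightarrow> x + y \<in> K" "x \<in> K \<Longrightarrow> r *\<^sub>R x \<in> K" for x y r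
    using K by (simp_all add: subspace_0 subspace_add subspace_scale)
  have JJ: "J x = J y \<longleftrightarrow> x = y" if "x \<in> K" "y \<in> K" for x y
    using inj_on_eq_iff[OF inj that] .
  have JW: "J x \<in> W" if "x \<in> K" for x using that by (simp add: W_def)
  have dJ: "carrier_dist W add smul nrm (J x) (J y) = dist x y" if "x \<in> K" "y \<in> K" for x y
    using that memK(3)[of y "-1"] memK(2)[of x "-1 *\<^sub>R y"]
    by (simp add: carrier_dist_def JW ops iJ dist_norm)
  let ?d = "carrier_dist W add smul nrm"
  have met: "Metric_space W ?d"
  proof
    show "0 \<le> ?d a b" for a b by (simp add: carrier_dist_def nrm_def)
    show "?d a b = ?d b a" for a b
    proof (cases "a \<in> W \<and> b \<in> W")
      case True
      then show ?thesis by (auto simp: W_def dJ[unfolded W_def] dist_commute)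
    qed (auto simp: carrier_dist_def)
    show "?d a b = 0 \<longleftrightarrow> a = b" if "a \<in> W" "b \<in> W" for a b
      using that by (auto simp: W_def dJ[unfolded W_def] JJ)
    show "?d a e \<le> ?d a b + ?d b e" if "a \<in> W" "b \<in> W" "e \<in> W" for a b e
      using that by (auto simp: W_def dJ[unfolded W_def] dist_triangle)
  qed
  interpret M: Metric_space W ?d by (rule met)
  have cont: "continuous_map (top_of_set K) M.mtopology J"
    unfolding M.continuous_map_to_metric
  proof (intro ballI allI impI)
    fix x and e :: real assume "x \<in> topspace (top_of_set K)" "e > 0"
    moreover have "openin (top_of_set K) (K \<inter> ball x e)" by (simp add: openin_open_Int)
    ultimately show "\<exists>U. openin (top_of_set K) U \<and> x \<in> U \<and> (\<forall>y\<in>U. J y \<in> M.mball (J x) e)"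
      by (intro exI[of _ "K \<inter> ball x e"]) (auto simp: M.in_mball dJ W_def[THEN eqset_imp_iff])
  qed
  have complK: "complete K"
    using closed_span_finite[OF B] by (simp add: K_def complete_eq_closed)
  have "M.mcomplete"
    unfolding M.mcomplete_def
  proof (intro allI impI)
    fix \<sigma> assume \<sigma>: "M.MCauchy \<sigma>"
    define s where "s = i \<circ> \<sigma>"
    have s: "s n \<in> K" "\<sigma> n = J (s n)" for n
    proof -
      have "\<sigma> n \<in> W" using \<sigma> unfolding M.MCauchy_def by blast
      then show "s n \<in> K" "\<sigma> n = J (s n)" by (auto simp: s_def iJ W_def)
    qed
    have "Cauchy s" unfolding Cauchy_def
      using \<sigma> s unfolding M.MCauchy_def by (simp add: dJ) 
    then obtain l where l: "l \<in> K" "s \<longlonglongrightarrow> l" using complK s(1) unfolding complete_def by blast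
    have "limitin M.mtopology \<sigma> (J l) sequentially"
      unfolding M.limitin_metric
    proof (intro conjI allI impI)
      show "J l \<in> W" using l by (simp add: W_def)
      fix e :: real assume "e > 0"
      then show "\<forall>\<^sub>F n in sequentially. \<sigma> n \<in> W \<and> ?d (\<sigma> n) (J l) < e"
        using l s tendstoD[OF l(2)] by (simp add: dJ JW)
    qed
    then show "\<exists>x. limitin M.mtopology \<sigma> x sequentially" by blast
  qed
  have W: "carrier_banach_space W add (J 0) smul nrm"
  proof
    show "M.mcomplete" by fact
    fix x assume "x \<in> W"
    then obtain u where u: "u \<in> K" "x = J u" unfolding W_def by blast
    show "\<exists>y\<in>W. add x y = J 0"
      using u memK(3)[of u "-1"] by (intro bexI[of _ "J (-1 *\<^sub>R u)"]) (simp_all add: W_def ops iJ)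
  qed (auto simp: W_def ops iJ memK JJ scaleR_add_right scaleR_add_left add_ac norm_triangle_ineq)
  define G' where "G' = J \<circ> G"
  have GK: "G x \<in> K" for x using G(2) by (simp add: K_def)
  have "carrier_banach_space.compact_operator W add smul nrm G'"
    unfolding carrier_banach_space.compact_operator_def[OF W] Let_def
  proof (intro conjI allI)
    show "range G' \<subseteq> W" using GK by (auto simp: G'_def W_def)
    show "G' (x + y) = add (G' x) (G' y)" for x y
      by (simp add: G'_def ops iJ GK linear_add[OF G(1)])
    show "G' (a *\<^sub>R x) = smul a (G' x)" for a x
      by (simp add: G'_def ops iJ GK linear_scale[OF G(1)])
    let ?Q = "cball 0 \<bar>c\<bar> \<inter> K"
    have "compact ?Q" unfolding K_def by (rule compact_cball_Int_span_finite[OF B])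
    then have "compactin (top_of_set K) ?Q" by (simp add: compactin_subtopology)
    then have Q: "compactin M.mtopology (J ` ?Q)" using cont by (rule image_compactin)
    have "G' ` cball 0 1 \<subseteq> J ` ?Q"
    proof (clarsimp simp: G'_def)
      fix x :: 'a assume "norm x \<le> 1"
      then have "c * norm x \<le> \<bar>c\<bar> * 1" by (intro mult_mono) auto
      then have "norm (G x) \<le> \<bar>c\<bar>" using G(3)[of x] by simp
      then show "J (G x) \<in> J ` ?Q" using GK by simp
    qed
    moreover have "closedin M.mtopology (J ` ?Q)"
      by (rule compactin_imp_closedin[OF M.Hausdorff_space_mtopology Q])
    ultimately have "M.mtopology closure_of (G' ` cball 0 1) \<subseteq> J ` ?Q" by (rule closure_of_minimal)
    then show "compactin M.mtopology (M.mtopology closure_of (G' ` cball 0 1))"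
      by (rule closed_compactin[OF Q]) simp
  qed
  moreover have "nrm (G' x) = norm (G x)" for x by (simp add: G'_def ops iJ GK)
  ultimately show thesis using that W by blast
qed

text \<open>The projection onto the kernel of the adjoint along the annihilator of \<open>E\<close> is bounded by the
  open mapping theorem modulo that annihilator. It supplies the component that the adjoint does
  not see.\<close>

lemma ker_and_range_adjoint_imp_compact_perturbation:
  fixes F :: "'v::banach \<Rightarrow>\<^sub>L 'x::banach"
  assumes B: "finite B" "{\<phi>. blinfun_apply (adjoint_op F) \<phi> = 0} = span B"
    and cl: "closed (range (blinfun_apply (adjoint_op F)))"
  shows "\<exists>(W :: 'w universe set) add zero smul nrm (G :: ('x \<Rightarrow>\<^sub>L real) \<Rightarrow> 'w universe) C.
          carrier_banach_space W add zero smul nrm \<and>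
          carrier_banach_space.compact_operator W add smul nrm G \<and> C > 0 \<and>
          (\<forall>\<phi>. norm \<phi> \<le> C * (norm (adjoint_op F \<phi>) + nrm (G \<phi>)))"
proof -
  obtain E where E: "finite E" "annihilator E \<inter> span B = {0}" "span (annihilator E \<union> B) = UNIV"
    "adjoint_bounded_below F E"
    using adjoint_bounded_below_on_complement[OF B cl] by blast
  let ?Y = "annihilator E"
  have subY: "subspace ?Y" by (rule subspace_annihilator)
  have "UNIV = {\<kappa> + \<psi> | \<kappa> \<psi>. \<kappa> \<in> span B \<and> \<psi> \<in> ?Y}"
    using span_Un_subspace[OF subY, of B] E(3) by (force simp: add.commute)
  then obtain c where c: "\<And>\<phi>. \<exists>\<kappa>\<in>span B. norm \<kappa> \<le> c * norm \<phi> \<and> \<phi> - \<kappa> \<in> ?Y"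
    using open_mapping_modulo[OF bounded_linear_ident subspace_span closed_span_finite[OF B(1)]
        subY closed_annihilator closed_UNIV] by (metis UNIV_I)
  then obtain P where P: "\<And>\<phi>. P \<phi> \<in> span B" "\<And>\<phi>. norm (P \<phi>) \<le> c * norm \<phi>" "\<And>\<phi>. \<phi> - P \<phi> \<in> ?Y"
    by metis
  have uniq: "P \<phi> = \<kappa>" if "\<kappa> \<in> span B" "\<phi> - \<kappa> \<in> ?Y" for \<phi> \<kappa>
  proof -
    have "(\<phi> - \<kappa>) - (\<phi> - P \<phi>) \<in> ?Y" by (rule subspace_diff[OF subY that(2) P(3)])
    then have "P \<phi> - \<kappa> \<in> ?Y" by simp
    moreover have "P \<phi> - \<kappa> \<in> span B" by (rule span_diff[OF P(1) that(1)])
    ultimately have "P \<phi> - \<kappa> \<in> {0}" using E(2) by blast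
    then show ?thesis by simp
  qed
  have "linear P"
  proof (rule linearI)
    show "P (\<phi> + \<psi>) = P \<phi> + P \<psi>" for \<phi> \<psi>
    proof (rule uniq[OF span_add[OF P(1) P(1)]])
      have "(\<phi> - P \<phi>) + (\<psi> - P \<psi>) \<in> ?Y" by (rule subspace_add[OF subY P(3) P(3)])
      then show "\<phi> + \<psi> - (P \<phi> + P \<psi>) \<in> ?Y" by (simp add: algebra_simps)
    qed
    show "P (r *\<^sub>R \<phi>) = r *\<^sub>R P \<phi>" for r \<phi>
    proof (rule uniq[OF span_scale[OF P(1)]])
      have "r *\<^sub>R (\<phi> - P \<phi>) \<in> ?Y" by (rule subspace_scale[OF subY P(3)])
      then show "r *\<^sub>R \<phi> - r *\<^sub>R P \<phi> \<in> ?Y" by (simp add: scaleR_diff_right)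
    qed
  qed
  obtain C where C: "C > 0" "\<And>\<phi>. \<phi> \<in> ?Y \<Longrightarrow> norm \<phi> \<le> C * norm (adjoint_op F \<phi>)"
    using E(4) unfolding adjoint_bounded_below_def by blast
  have est: "norm \<phi> \<le> (C + 1) * (norm (adjoint_op F \<phi>) + norm (P \<phi>))" for \<phi>
  proof -
    have "blinfun_apply (adjoint_op F) (P \<phi>) = 0" using P(1) B(2) by blast
    then have eq: "blinfun_apply (adjoint_op F) (\<phi> - P \<phi>) = blinfun_apply (adjoint_op F) \<phi>"
      using blinfun.diff_right[of "adjoint_op F" \<phi> "P \<phi>"] by simp
    have "norm \<phi> \<le> norm (\<phi> - P \<phi>) + norm (P \<phi>)" by (metis diff_add_cancel norm_triangle_ineq)
    also have "\<dots> \<le> C * norm (adjoint_op F \<phi>) + norm (P \<phi>)" 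
      using C(2)[OF P(3)[of \<phi>]] unfolding eq by simp
    also have "\<dots> \<le> (C + 1) * (norm (adjoint_op F \<phi>) + norm (P \<phi>))"
      using C(1) by (simp add: algebra_simps)
    finally show ?thesis .
  qed
  obtain W :: "'w universe set" and add zero smul nrm G
    where W: "carrier_banach_space W add zero smul nrm"
      "carrier_banach_space.compact_operator W add smul nrm G" "\<And>\<phi>. nrm (G \<phi>) = norm (P \<phi>)"
    using finite_rank_imp_carrier_compact[OF B(1) \<open>linear P\<close> P(1,2)] by blast
  have "C + 1 > 0" using C(1) by simp
  moreover have "\<forall>\<phi>. norm \<phi> \<le> (C + 1) * (norm (adjoint_op F \<phi>) + nrm (G \<phi>))"
    using est W(3) by simp
  ultimately show ?thesis using W(1,2) by blast
qed

section \<open>Characterisations of finite codimensionality\<close>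

theorem theorem3p1:
  fixes F :: "'v::banach \<Rightarrow>\<^sub>L 'x::banach" and M :: "'x set"
  assumes "reflexive_space TYPE('v)" and "reflexive_space TYPE('x)"
    and "M = {blinfun_apply F v | v. norm v \<le> 1}"
  shows
    "(finite_codim_set M \<longleftrightarrow>
        finite_codim_subspace (range (blinfun_apply F)) \<and> closed (range (blinfun_apply F)))
   \<and> (finite_codim_set M \<longleftrightarrow>
        (\<exists>(Y :: ('x \<Rightarrow>\<^sub>L real) set) C. finite_codim_subspace Y \<and> closed Y \<and> C > 0 \<and>
          (\<forall>\<phi>\<in>Y. norm \<phi> \<le> C * norm (blinfun_apply (adjoint_op F) \<phi>))))
   \<and> (finite_codim_set M \<longleftrightarrow>
        (\<exists>(W :: 'w universe set) add zero smul nrm (G :: ('x \<Rightarrow>\<^sub>L real) \<Rightarrow> 'w universe) C.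
          carrier_banach_space W add zero smul nrm \<and>
          carrier_banach_space.compact_operator W add smul nrm G \<and> C > 0 \<and>
          (\<forall>\<phi>. norm \<phi> \<le> C * (norm (blinfun_apply (adjoint_op F) \<phi>) + nrm (G \<phi>)))))
   \<and> (finite_codim_set M \<longleftrightarrow>
        (\<exists>B. finite B \<and> {\<phi>. blinfun_apply (adjoint_op F) \<phi> = 0} = span B) \<and>
        closed (range (blinfun_apply (adjoint_op F))))"
proof -
  let ?T = "blinfun_apply (adjoint_op F)"
  let ?R = "range (blinfun_apply F)"
  let ?c2 = "finite_codim_subspace ?R \<and> closed ?R"
  let ?c3 = "\<exists>(Y :: ('x \<Rightarrow>\<^sub>L real) set) C. finite_codim_subspace Y \<and> closed Y \<and> C > 0 \<and>
      (\<forall>\<phi>\<in>Y. norm \<phi> \<le> C * norm (?T \<phi>))"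
  let ?c4 = "\<exists>(W :: 'w universe set) add zero smul nrm (G :: ('x \<Rightarrow>\<^sub>L real) \<Rightarrow> 'w universe) C.
      carrier_banach_space W add zero smul nrm \<and>
      carrier_banach_space.compact_operator W add smul nrm G \<and> C > 0 \<and>
      (\<forall>\<phi>. norm \<phi> \<le> C * (norm (?T \<phi>) + nrm (G \<phi>)))"
  let ?c5 = "(\<exists>B. finite B \<and> {\<phi>. ?T \<phi> = 0} = span B) \<and> closed (range ?T)"
  let ?est = "\<exists>E. finite E \<and> adjoint_bounded_below F E"
  have 1: "finite_codim_set M \<longleftrightarrow> ?c2"
    unfolding assms(3)
    using finite_codim_set_imp_closed_range[of F] closed_range_imp_finite_codim_set[of F] by blast
  have 2: "?est" if "?c2"
    using closed_range_imp_adjoint_bounded_below[of F] that by blast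
  have 3: "?c3" if "?est"
    using that finite_codim_annihilator closed_annihilator
    unfolding adjoint_bounded_below_def by blast
  have 4: "?c5" if "?c3"
  proof -
    obtain Y and C :: real where Y: "finite_codim_subspace Y" "closed Y" and C: "C > 0"
      and bd: "\<And>\<phi>. \<phi> \<in> Y \<Longrightarrow> norm \<phi> \<le> C * norm (?T \<phi>)"
      using \<open>?c3\<close> by blast
    show ?thesis using bounded_below_imp_ker_and_range_adjoint[OF Y C bd] by blast
  qed
  have 5: "?c2" if "?c5"
    using that ker_and_range_adjoint_imp_closed_range[of _ F] by blast
  have 6: "?c4" if "?c5"
  proof -
    obtain B where B: "finite B" "{\<phi>. ?T \<phi> = 0} = span B" using \<open>?c5\<close> by blast
    show ?thesis
      by (rule ker_and_range_adjoint_imp_compact_perturbation[OF B]) (use \<open>?c5\<close> in blast)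
  qed
  have 7: "?est" if "?c4"
  proof -
    obtain W :: "'w universe set" and add zero smul nrm G C
      where W: "carrier_banach_space W add zero smul nrm"
        "carrier_banach_space.compact_operator W add smul nrm G" "C > 0"
        "\<And>\<phi>. norm \<phi> \<le> C * (norm (?T \<phi>) + nrm (G \<phi>))"
      using \<open>?c4\<close> by blast
    show ?thesis by (rule compact_perturbation_imp_adjoint_bounded_below[OF W])
  qed
  have "finite_codim_set M \<longleftrightarrow> ?c3" using 1 2 3 4 5 by argo
  moreover have "finite_codim_set M \<longleftrightarrow> ?c4" using 1 2 3 4 5 6 7 by argo
  moreover have "finite_codim_set M \<longleftrightarrow> ?c5" using 1 2 3 4 5 by argo
  ultimately show ?thesis using 1 by blast
qed

end
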